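(* Let $\eta_t=\eta t^{-\alpha}$ for $t\ge1$ with $\eta>0$, $\alpha\in(1/2,1)$. Fix $p>2$, $q\in[1,p/2]$ and $\gamma>0$, and suppose $$\gamma<\min\Big\{\frac{p-2}{2(p+1)},\frac{1-\alpha}{2}\Big\}.$$ Then there exists a class $\mathfrak C_{\mathrm{cov}}$ of stochastic oracles whose dynamics satisfy conditions (A1)–(A5) of the context uniformly over the class, with limiting variance $S_{\mathcal M}=1$ for every $\mathcal M\in\mathfrak C_{\mathrm{cov}}$ and with covariance-stabilization exponent $\gamma$ in (A4), and there exist constants $c>0$ and $T_0<\infty$ such that, for every integer $T\ge T_0$, $$\mathcal D_T(\mathfrak C_{\mathrm{cov}})\ge c\,T^{-\gamma}.$$
   Context: Stochastic oracle. A (scalar) stochastic oracle is a tuple $\mathcal M=(g_{\mathcal M},(\epsilon_t^{\mathcal M})_{t\ge1},(\mathcal F_t^{\mathcal M})_{t\ge0},\mathbb P_{\mathcal M})$ where $g_{\mathcal M}:\mathbb R\to\mathbb R$ is a mean field with root $x^\star=0$ and $(\epsilon_t^{\mathcal M})$ is a martingale-difference sequence adapted to $(\mathcal F_t^{\mathcal M})$ under $\mathbb P_{\mathcal M}$ (expectation $\mathbb E_{\mathcal M}$). Its dynamics are $x_1^{\mathcal M}=0$, $x_{t+1}^{\mathcal M}=x_t^{\mathcal M}-\eta_tg_{\mathcal M}(x_t^{\mathcal M})+\eta_t\epsilon_t^{\mathcal M}$. The path $\Phi_T^{\mathcal M}:[0,1]\to\mathbb R$ has $\Phi_T^{\mathcal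 M}(n/T)=T^{-1/2}\sum_{t=1}^nx_{t+1}^{\mathcal M}$, $0\le n\le T$, and is linearly interpolated in between. Conditions (with $x^\star=0$). (A1) For some $G_{\mathcal M}>0$, $\delta_g>0$, $C_{\mathrm{sm}},C_{\mathrm{bd}}<\infty$: $|g_{\mathcal M}(x)-G_{\mathcal M}x|\le C_{\mathrm{sm}}x^2$ for $|x|\le\delta_g$ and $\sup_{x\in\mathbb R}|g_{\mathcal M}(x)-G_{\mathcal M}x|\le C_{\mathrm{bd}}$. (A2) The step sizes are $\eta_t=\eta t^{-\alpha}$, $\eta>0$, $\alpha\in(1/2,1)$. (A3) For a deterministic $M_p<\infty$, a.s. for all $t\ge1$: $\mathbb E_{\mathcal M}[\epsilon_t^{\mathcal M}\mid\mathcal F_{t-1}^{\mathcal M}]=0$ and $\mathbb E_{\mathcal M}[|\epsilon_t^{\mathcal M}|^p\mid\mathcal F_{t-1}^{\mathcal M}]\le M_p$. (A4) For some $S_{\mathcal M}\ge0$ (the limiting variance), $C_S<\infty$ and exponent $\gamma>0$, for every integer $m\ge2$: $\mathbb E_{\mathcal M}\big[\max_{0\le n\le m}\big|\frac1m\sum_{t=1}^n\mathbb E_{\mathcal M}[(\epsilon_t^{\mathcal M})^2\mid\mathcal F_{t-1}^{\mathcal M}]-\frac nmS_{\mathcal M}\big|\big]\le C_Sm^{-3\gamma}$. (A5) For some $C_\Delta<\infty$: $\mathbb E_{\mathcal M}[|x_t^{\mathcal M}|^{2q}]\le C_\Delta\eta_t^q$ for every $t\ge1$. "Uniformly over the class"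 means that the constants $\delta_g,C_{\mathrm{sm}},C_{\mathrm{bd}},M_p,C_S,\gamma,C_\Delta$ can be chosen the same for all oracles of the class. Target and worst-case error. $Z^{\mathcal M}=G_{\mathcal M}^{-1}S_{\mathcal M}^{1/2}W_\star^{(1)}$ with $W_\star^{(1)}$ a standard one-dimensional Brownian motion on $[0,1]$, and $\mathcal D_T(\mathfrak C)=\sup_{\mathcal M\in\mathfrak C}d_{\mathrm P}(\Phi_T^{\mathcal M},Z^{\mathcal M})$. Metrics. With $\Lambda$ the set of strictly increasing continuous bijections of $[0,1]$, for càdlàg $f,h\in D([0,1],\mathbb R)$: $d_{\mathrm S}(f,h)=\inf_{\lambda\in\Lambda}\{\sup_{0\le s<t\le1}|\log\frac{\lambda(t)-\lambda(s)}{t-s}|\vee\sup_{r}|f(\lambda(r))-h(r)|\}$. $d_{\mathrm P}(\mu,\nu)$ is the infimum of $\delta>0$ such that $\mu(\Gamma)\le\nu(\Gamma^\delta)+\delta$ and $\nu(\Gamma)\le\mu(\Gamma^\delta)+\delta$ for every Borel $\Gamma\subset(D([0,1],\mathbb R),d_{\mathrm S})$, where $\Gamma^\delta=\{h:\inf_{f\in\Gamma}d_{\mathrm S}(f,h)<\delta\}$; for random elements it is applied to their laws. *)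

theory Defs
  imports "HOL-Probability.Probability"
begin

section \<open>Skorokhod space on the unit interval\<close>

text \<open>
  Paths are functions of type \<open>real \<Rightarrow> real\<close> that are \<open>undefined\<close> outside the unit interval, so that
  equality of paths is pointwise equality on the unit interval.
\<close>

definition cadlag_space :: "(real \<Rightarrow> real) set" where
  "cadlag_space = {f \<in> extensional {0..1}.
     (\<forall>t\<in>{0..<1}. (f \<longlongrightarrow> f t) (at_right t)) \<and>
     (\<forall>t\<in>{0<..1}. \<exists>l. (f \<longlongrightarrow> l) (at_left t))}"

definition time_changes :: "(real \<Rightarrow> real) set" where
  "time_changes = {l. continuous_on {0..1} l \<and> strict_mono_on {0..1} l \<and> bij_betw l {0..1} {0..1}}"

text \<open>
  The distances take values in \<open>ereal\<close>: the logarithmic slopes of a time change may be unbounded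
  (supremum \<open>\<infinity>\<close>), and the distance to the empty set has to be \<open>\<infinity>\<close>.
\<close>

definition skorokhod_dist :: "(real \<Rightarrow> real) \<Rightarrow> (real \<Rightarrow> real) \<Rightarrow> ereal" where
  "skorokhod_dist f h = (INF l\<in>time_changes.
     max (SUP (s, t)\<in>{(s, t). 0 \<le> s \<and> s < t \<and> t \<le> 1}. ereal \<bar>ln ((l t - l s) / (t - s))\<bar>)
         (SUP r\<in>{0..1}. ereal \<bar>f (l r) - h r\<bar>))"

definition skorokhod_open :: "(real \<Rightarrow> real) set \<Rightarrow> bool" where
  "skorokhod_open U \<longleftrightarrow> U \<subseteq> cadlag_space \<and>
     (\<forall>f\<in>U. \<exists>r>0. \<forall>h\<in>cadlag_space. skorokhod_dist f h < ereal r \<longrightarrow> h \<in> U)"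

definition skorokhod_borel :: "(real \<Rightarrow> real) measure" where
  "skorokhod_borel = sigma cadlag_space {U. skorokhod_open U}"

definition skorokhod_nbhd :: "(real \<Rightarrow> real) set \<Rightarrow> real \<Rightarrow> (real \<Rightarrow> real) set" where
  "skorokhod_nbhd \<Gamma> \<delta> = {h \<in> cadlag_space. (INF f\<in>\<Gamma>. skorokhod_dist f h) < ereal \<delta>}"

definition prokhorov_dist :: "(real \<Rightarrow> real) measure \<Rightarrow> (real \<Rightarrow> real) measure \<Rightarrow> ereal" where
  "prokhorov_dist \<mu> \<nu> = (INF \<delta>\<in>{\<delta>. 0 < \<delta> \<and> (\<forall>\<Gamma>\<in>sets skorokhod_borel.
       measure \<mu> \<Gamma> \<le> measure \<nu> (skorokhod_nbhd \<Gamma> \<delta>) + \<delta> \<and>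
       measure \<nu> \<Gamma> \<le> measure \<mu> (skorokhod_nbhd \<Gamma> \<delta>) + \<delta>)}. ereal \<delta>)"


section \<open>Standard Brownian motion on the unit interval\<close>

definition standard_brownian_motion :: "'w measure \<Rightarrow> (real \<Rightarrow> 'w \<Rightarrow> real) \<Rightarrow> bool" where
  "standard_brownian_motion N W \<longleftrightarrow>
     prob_space N \<and>
     (\<forall>t\<in>{0..1}. W t \<in> borel_measurable N) \<and>
     (\<forall>\<omega>\<in>space N. W 0 \<omega> = 0 \<and> continuous_on {0..1} (\<lambda>t. W t \<omega>)) \<and>
     (\<forall>s t. 0 \<le> s \<and> s < t \<and> t \<le> 1 \<longrightarrow>
        distributed N lborel (\<lambda>\<omega>. W t \<omega> - W s \<omega>) (normal_density 0 (sqrt (t - s)))) \<and>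
     (\<forall>(n::nat) \<tau>. (\<forall>i\<le>n. \<tau> i \<in> {0..1}) \<and> (\<forall>i<n. \<tau> i < \<tau> (Suc i)) \<longrightarrow>
        prob_space.indep_vars N (\<lambda>_. borel) (\<lambda>i \<omega>. W (\<tau> (Suc i)) \<omega> - W (\<tau> i) \<omega>) {..<n})"


section \<open>Stochastic oracles\<close>

text \<open>The noise is indexed from 1; the value of \<open>noise\<close> at 0 is never used.\<close>

record 'w sa_oracle =
  mean_field :: "real \<Rightarrow> real"
  noise :: "nat \<Rightarrow> 'w \<Rightarrow> real"
  filt :: "nat \<Rightarrow> 'w measure"
  law :: "'w measure"

definition stochastic_oracle :: "'w sa_oracle \<Rightarrow> bool" where
  "stochastic_oracle M \<longleftrightarrow>
     prob_space (law M) \<and>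
     mean_field M \<in> borel_measurable borel \<and> mean_field M 0 = 0 \<and>
     filtration (space (law M)) (filt M) \<and> (\<forall>t. subalgebra (law M) (filt M t)) \<and>
     (\<forall>t\<ge>1. noise M t \<in> borel_measurable (filt M t) \<and> integrable (law M) (noise M t) \<and>
        (AE \<omega> in law M. real_cond_exp (law M) (filt M (t - 1)) (noise M t) \<omega> = 0))"

definition step_size :: "real \<Rightarrow> real \<Rightarrow> nat \<Rightarrow> real" where
  "step_size \<eta> \<alpha> t = \<eta> * real t powr (- \<alpha>)"

text \<open>The recursion starts at index 1; the value at index 0 is a dummy.\<close>

fun iterate :: "(nat \<Rightarrow> real) \<Rightarrow> 'w sa_oracle \<Rightarrow> nat \<Rightarrow> 'w \<Rightarrow> real" where
  "iterate step M 0 \<omega> = 0"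
| "iterate step M (Suc 0) \<omega> = 0"
| "iterate step M (Suc (Suc t)) \<omega> = iterate step M (Suc t) \<omega>
     - step (Suc t) * mean_field M (iterate step M (Suc t) \<omega>) + step (Suc t) * noise M (Suc t) \<omega>"

text \<open>
  Linear interpolation of the partial sums: on \<open>[n/T, (n+1)/T]\<close> the path runs from the sum of
  \<open>x\<^sub>2, \<dots>, x\<^bsub>n+1\<^esub>\<close> to the same sum with \<open>x\<^bsub>n+2\<^esub>\<close> added, divided by \<open>\<surd>T\<close>.
\<close>

definition sa_path :: "(nat \<Rightarrow> real) \<Rightarrow> nat \<Rightarrow> 'w sa_oracle \<Rightarrow> 'w \<Rightarrow> real \<Rightarrow> real" where
  "sa_path step T M \<omega> = (\<lambda>r\<in>{0..1}. let n = nat \<lfloor>real T * r\<rfloor> in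
     ((\<Sum>t=1..n. iterate step M (t + 1) \<omega>) + (real T * r - real n) * iterate step M (n + 2) \<omega>)
       / sqrt (real T))"


section \<open>Conditions on the oracles\<close>

definition cond_A1 :: "(real \<Rightarrow> real) \<Rightarrow> real \<Rightarrow> real \<Rightarrow> real \<Rightarrow> real \<Rightarrow> bool" where
  "cond_A1 g G \<delta>g Csm Cbd \<longleftrightarrow> G > 0 \<and> \<delta>g > 0 \<and>
     (\<forall>x. \<bar>x\<bar> \<le> \<delta>g \<longrightarrow> \<bar>g x - G * x\<bar> \<le> Csm * x\<^sup>2) \<and> (\<forall>x. \<bar>g x - G * x\<bar> \<le> Cbd)"

text \<open>
  Moments that are not known to be finite are taken with \<open>nn_cond_exp\<close> and \<open>nn_integral\<close>, because
  \<open>real_cond_exp\<close> and the Bochner integral return 0 when the expectation is infinite. The conditional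
  second moment in \<open>cond_A4\<close> is that of an integrable variable under \<open>cond_A3\<close> with \<open>p > 2\<close>.
\<close>

definition cond_A3 :: "'w sa_oracle \<Rightarrow> real \<Rightarrow> real \<Rightarrow> bool" where
  "cond_A3 M p Mp \<longleftrightarrow> (AE \<omega> in law M. \<forall>t\<ge>1.
     real_cond_exp (law M) (filt M (t - 1)) (noise M t) \<omega> = 0 \<and>
     nn_cond_exp (law M) (filt M (t - 1)) (\<lambda>\<omega>. ennreal (\<bar>noise M t \<omega>\<bar> powr p)) \<omega> \<le> ennreal Mp)"

definition cond_A4 :: "'w sa_oracle \<Rightarrow> real \<Rightarrow> real \<Rightarrow> real \<Rightarrow> bool" where
  "cond_A4 M S CS \<gamma> \<longleftrightarrow> S \<ge> 0 \<and> (\<forall>m\<ge>2.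
     (\<integral>\<^sup>+ \<omega>. ennreal (MAX n\<in>{0..m}.
         \<bar>1 / real m * (\<Sum>t=1..n. real_cond_exp (law M) (filt M (t - 1)) (\<lambda>\<omega>. (noise M t \<omega>)\<^sup>2) \<omega>)
            - real n / real m * S\<bar>) \<partial>law M)
       \<le> ennreal (CS * real m powr (- 3 * \<gamma>)))"

definition cond_A5 :: "'w sa_oracle \<Rightarrow> (nat \<Rightarrow> real) \<Rightarrow> real \<Rightarrow> real \<Rightarrow> bool" where
  "cond_A5 M step q C\<Delta> \<longleftrightarrow> (\<forall>t\<ge>1.
     (\<integral>\<^sup>+ \<omega>. ennreal (\<bar>iterate step M t \<omega>\<bar> powr (2 * q)) \<partial>law M) \<le> ennreal (C\<Delta> * step t powr q))"

text \<open>
  \<open>G M\<close> and \<open>S M\<close> are the slope and the limiting variance of \<open>M\<close>, which may vary over the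
  class; all other constants are shared by the whole class. The step sizes are those of \<open>step_size\<close>.
\<close>

definition uniform_class ::
  "'w sa_oracle set \<Rightarrow> ('w sa_oracle \<Rightarrow> real) \<Rightarrow> ('w sa_oracle \<Rightarrow> real) \<Rightarrow> (nat \<Rightarrow> real) \<Rightarrow>
     real \<Rightarrow> real \<Rightarrow> real \<Rightarrow> bool" where
  "uniform_class \<CC> G S step p q \<gamma> \<longleftrightarrow>
     (\<exists>\<delta>g Csm Cbd Mp CS C\<Delta>. \<forall>M\<in>\<CC>.
        stochastic_oracle M \<and>
        cond_A1 (mean_field M) (G M) \<delta>g Csm Cbd \<and>
        cond_A3 M p Mp \<and>
        cond_A4 M (S M) CS \<gamma> \<and>
        cond_A5 M step q C\<Delta>)"


section \<open>Worst-case error\<close>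

definition target_path :: "(real \<Rightarrow> 'v \<Rightarrow> real) \<Rightarrow> real \<Rightarrow> real \<Rightarrow> 'v \<Rightarrow> real \<Rightarrow> real" where
  "target_path W G S \<omega> = (\<lambda>r\<in>{0..1}. inverse G * sqrt S * W r \<omega>)"

definition worst_case_error ::
  "'v measure \<Rightarrow> (real \<Rightarrow> 'v \<Rightarrow> real) \<Rightarrow> (nat \<Rightarrow> real) \<Rightarrow> nat \<Rightarrow>
     'w sa_oracle set \<Rightarrow> ('w sa_oracle \<Rightarrow> real) \<Rightarrow> ('w sa_oracle \<Rightarrow> real) \<Rightarrow> ereal" where
  "worst_case_error N W step T \<CC> G S = (SUP M\<in>\<CC>.
     prokhorov_dist (distr (law M) skorokhod_borel (sa_path step T M))
                    (distr N skorokhod_borel (target_path W (G M) (S M))))"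

end

theory Submission
  imports Defs
begin

text \<open>
  Evaluation at the endpoint, \<open>f \<mapsto> f 1\<close>, is 1-Lipschitz for the Skorokhod distance
  (\<open>skorokhod_dist_ge_endpoint\<close>), because every time change fixes 1. So it is enough that the law of
  \<open>\<Phi>\<^sub>T(1)\<close> charges an interval of width of order \<open>T\<^sup>-\<^sup>\<gamma>\<close> too heavily, by an amount of the same order.

  Take the linear mean field \<open>x / \<eta>\<close>. The recursion is then linear with factors \<open>1 - t powr (- \<alpha>)\<close> in
  \<open>[0, 1]\<close>, and \<open>\<Phi>\<^sub>T(1)\<close> is \<open>\<eta>\<close> times the sum of the noise up to \<open>T\<close> with explicit deterministic weights
  (\<open>path_weight\<close>). The noise consists of independent standard Gaussians, with one exception. At the time
  \<open>n = T - \<lceil>T\<^sup>1\<^sup>-\<^sup>2\<^sup>\<gamma>\<rceil>\<close> split this weighted sum into the part \<open>Y\<close> up to \<open>n\<close> and the part \<open>Z\<close> after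
  \<open>n\<close>, and let \<open>\<epsilon>\<close> be the standard deviation of \<open>Z\<close>. If \<open>\<bar>Y\<bar> < \<epsilon>\<close>, the noise is switched off until time \<open>T\<close>.

  Without the switch, the mass that \<open>Z\<close> moves out of \<open>(- \<epsilon>, \<epsilon>)\<close> nearly balances the mass that it moves in. With
  the switch nothing leaves, while a fixed proportion of the mass next to the interval still enters. The
  interval thus has probability at least \<open>\<epsilon> (2 + r) / \<surd>(2 \<pi>)\<close> up to a factor tending to 1, for a constant
  \<open>r > 0\<close>, against at most \<open>2 \<epsilon> / \<surd>(2 \<pi>)\<close> under the target (\<open>prob_final_value_near_zero_ge\<close>,
  \<open>target_endpoint_le\<close>). A Prokhorov tolerance \<open>\<delta>\<close> has to cover the excess, so \<open>\<delta>\<close> is at least a constant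
  times \<open>\<epsilon>\<close>.

  The price in the covariance condition is small: the switch acts with probability \<open>O(\<epsilon>)\<close> and removes a
  proportion of order \<open>T\<^sup>-\<^sup>2\<^sup>\<gamma>\<close> of the total variance, which gives \<open>T\<^sup>-\<^sup>3\<^sup>\<gamma>\<close> when \<open>\<epsilon>\<close> is of order \<open>T\<^sup>-\<^sup>\<gamma>\<close>
  (\<open>cond_A4_worst_oracle\<close>).

  On each side of the switch the endpoint is a Gaussian linear combination of the noise, without remainder.
  What is left is to control the deterministic weights (\<open>sd_bounds\<close>). Multiplied by \<open>\<surd>T\<close>, they are
  asymptotically at most 1 in quadratic mean, and at least one half except during
  the last \<open>T\<^sup>\<alpha>\<close> steps, whose noise has not yet passed from the iterates into the path. The hypothesis
  \<open>\<gamma> < (1 - \<alpha>) / 2\<close> makes the window of length \<open>T\<^sup>1\<^sup>-\<^sup>2\<^sup>\<gamma>\<close> longer than this, so that \<open>Z\<close> does have standard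
  deviation of order \<open>T\<^sup>-\<^sup>\<gamma>\<close>.
\<close>

section \<open>Linear response of the recursion\<close>

text \<open>
  The coefficient of the noise at time \<open>s\<close> in the iterate at time \<open>t + 1\<close>, divided by \<open>\<eta>\<close>, when the mean
  field is \<open>x / \<eta>\<close>. In this normalization \<open>\<eta>\<close> drops out of the recursion, which becomes
  \<open>y\<^bsub>t+1\<^esub> = (1 - a\<^sub>t) y\<^sub>t + a\<^sub>t \<epsilon>\<^sub>t\<close> with \<open>a\<^sub>t = t powr (- \<alpha>)\<close>, a convex combination.
\<close>

definition response :: "real \<Rightarrow> nat \<Rightarrow> nat \<Rightarrow> real" where
  "response \<alpha> s t = step_size 1 \<alpha> s * (\<Prod>j\<in>{s<..t}. 1 - step_size 1 \<alpha> j)"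

text \<open>
  The coefficient of the noise at time \<open>s\<close> in \<open>(x\<^sub>2 + \<dots> + x\<^bsub>T+1\<^esub>) / \<eta>\<close>.
\<close>

definition weight :: "real \<Rightarrow> nat \<Rightarrow> nat \<Rightarrow> real" where
  "weight \<alpha> T s = (\<Sum>t=s..T. response \<alpha> s t)"

text \<open>
  This is weighted AM-GM for \<open>1 + x\<close> and \<open>1\<close>.
\<close>

lemma bernoulli_powr:
  fixes x a :: real
  assumes "x > -1" "0 \<le> a" "a \<le> 1"
  shows "(1 + x) powr a \<le> 1 + a * x"
  using Youngs_inequality_0[of a "1 - a" "1 + x" 1] assms by (simp add: algebra_simps)

lemma step_size_1_bounds:
  assumes "t \<ge> 1" "0 < \<alpha>"
  shows "0 < step_size 1 \<alpha> t" "step_size 1 \<alpha> t \<le> 1"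
  using assms powr_mono[of "-\<alpha>" 0 "real t"] by (auto simp: step_size_def)

lemma step_size_antimono:
  assumes "1 \<le> s" "s \<le> t" "0 < \<alpha>"
  shows "step_size 1 \<alpha> t \<le> step_size 1 \<alpha> s"
  using assms by (auto simp: step_size_def intro!: powr_mono2')

lemma powr_increment_le:
  fixes \<alpha> :: real
  assumes "s \<ge> 1" "0 < \<alpha>" "\<alpha> < 1"
  shows "real (Suc s) powr \<alpha> \<le> real s powr \<alpha> + \<alpha> * real s powr (\<alpha> - 1)"
proof -
  have "real (Suc s) = real s * (1 + 1 / real s)"
    using assms by (simp add: field_simps)
  then have "real (Suc s) powr \<alpha> = real s powr \<alpha> * (1 + 1 / real s) powr \<alpha>"
    by (simp add: powr_mult del: of_nat_Suc)
  also have "\<dots> \<le> real s powr \<alpha> * (1 + \<alpha> * (1 / real s))"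
    using assms by (intro mult_left_mono bernoulli_powr) (auto intro: less_le_trans[of _ 0])
  also have "\<dots> = real s powr \<alpha> + \<alpha> * real s powr (\<alpha> - 1)"
    using assms by (simp add: powr_diff algebra_simps)
  finally show ?thesis .
qed

text \<open>
  The steps decrease so slowly that one step loses only the relative amount \<open>\<alpha> / t\<close>. This is what keeps
  \<open>a\<^sub>t / (1 - \<alpha>)\<close> a supersolution of the variance recursion in \<open>sum_response_sq_le\<close>.
\<close>

lemma step_size_decrement_le:
  assumes "t \<ge> 1" "0 < \<alpha>" "\<alpha> < 1"
  shows "step_size 1 \<alpha> t * (1 - \<alpha> / real t) \<le> step_size 1 \<alpha> (Suc t)"
proof -
  define A where "A = real t powr \<alpha>"
  define B where "B = real (Suc t) powr \<alpha>"
  have pos: "A > 0" "B > 0" using assms by (auto simp: A_def B_def)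
  have "B \<le> A * (1 + \<alpha> / real t)"
    using powr_increment_le[OF assms] assms by (simp add: A_def B_def powr_diff field_simps)
  then have "B * (1 - \<alpha> / real t) \<le> A * (1 + \<alpha> / real t) * (1 - \<alpha> / real t)"
    using assms by (intro mult_right_mono) (auto simp: field_simps)
  also have "\<dots> = A * (1 - (\<alpha> / real t)\<^sup>2)" by algebra
  also have "\<dots> \<le> A" using pos by (simp add: mult_le_cancel_left2)
  finally have "(1 - \<alpha> / real t) / A \<le> 1 / B" using pos by (simp add: field_simps)
  then show ?thesis by (simp add: step_size_def A_def B_def powr_minus_divide del: of_nat_Suc)
qed

lemma response_self [simp]: "response \<alpha> t t = step_size 1 \<alpha> t"
  by (simp add: response_def)

lemma response_Suc:
  assumes "s \<le> t"
  shows "response \<alpha> s (Suc t) = (1 - step_size 1 \<alpha> (Suc t)) * response \<alpha> s t"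
proof -
  have "{s<..Suc t} = insert (Suc t) {s<..t}" using assms by auto
  then show ?thesis by (simp add: response_def)
qed

lemma response_nonneg:
  assumes "0 < \<alpha>" "1 \<le> s"
  shows "0 \<le> response \<alpha> s t"
  using assms step_size_1_bounds(2)[of _ \<alpha>] step_size_1_bounds(1)[of s \<alpha>]
  by (auto simp: response_def intro!: prod_nonneg mult_nonneg_nonneg)

lemma weight_nonneg: "0 < \<alpha> \<Longrightarrow> 1 \<le> s \<Longrightarrow> 0 \<le> weight \<alpha> T s"
  by (simp add: weight_def response_nonneg sum_nonneg)

lemma weight_pos:
  assumes "0 < \<alpha>" "1 \<le> s" "s \<le> T"
  shows "0 < weight \<alpha> T s"
  unfolding weight_def using assms step_size_1_bounds(1)[of s \<alpha>]
  by (intro sum_pos2[of _ s]) (auto intro: response_nonneg)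

lemma iterate_eq_sum_response:
  assumes "\<eta> > 0" "mean_field M = (\<lambda>x. x / \<eta>)"
  shows "iterate (step_size \<eta> \<alpha>) M (Suc t) \<omega> = \<eta> * (\<Sum>s=1..t. response \<alpha> s t * noise M s \<omega>)"
proof (induction t)
  case (Suc t)
  have st: "step_size \<eta> \<alpha> k = \<eta> * step_size 1 \<alpha> k" for k by (simp add: step_size_def)
  have "iterate (step_size \<eta> \<alpha>) M (Suc (Suc t)) \<omega>
      = (1 - step_size 1 \<alpha> (Suc t)) * iterate (step_size \<eta> \<alpha>) M (Suc t) \<omega>
        + \<eta> * step_size 1 \<alpha> (Suc t) * noise M (Suc t) \<omega>"
    using assms by (simp add: st algebra_simps)
  also have "\<dots> = \<eta> * ((\<Sum>s=1..t. response \<alpha> s (Suc t) * noise M s \<omega>)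
       + response \<alpha> (Suc t) (Suc t) * noise M (Suc t) \<omega>)"
    by (simp add: Suc.IH response_Suc sum_distrib_left algebra_simps)
  finally show ?case by simp
qed simp

lemma sum_iterate_eq_sum_weight:
  assumes "\<eta> > 0" "mean_field M = (\<lambda>x. x / \<eta>)"
  shows "(\<Sum>t=1..T. iterate (step_size \<eta> \<alpha>) M (t + 1) \<omega>) = \<eta> * (\<Sum>s=1..T. weight \<alpha> T s * noise M s \<omega>)"
proof -
  have "(\<Sum>t=1..T. \<Sum>s=1..t. response \<alpha> s t * noise M s \<omega>)
      = (\<Sum>s=1..T. \<Sum>t=s..T. response \<alpha> s t * noise M s \<omega>)"
    unfolding sum.Sigma[OF finite_atLeastAtMost ballI[OF finite_atLeastAtMost]]
    by (rule sum.reindex_bij_witness[of _ "\<lambda>(a, b). (b, a)" "\<lambda>(a, b). (b, a)"]) auto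
  then show ?thesis
    using iterate_eq_sum_response[OF assms]
    by (simp add: weight_def sum_distrib_left[symmetric] sum_distrib_right[symmetric] del: iterate.simps)
qed

text \<open>
  With unit noise variance, the variance \<open>u\<^sub>t\<close> of the normalized iterate \<open>y\<^sub>t\<close> satisfies
  \<open>u\<^bsub>t+1\<^esub> = (1 - a\<^sub>t)\<^sup>2 u\<^sub>t + a\<^sub>t\<^sup>2\<close>. The bound \<open>u\<^sub>t \<le> a\<^sub>t / (1 - \<alpha>)\<close> propagates: net of the new
  noise, the damping gains \<open>\<alpha> a\<^sub>t\<^sup>2 / (1 - \<alpha>)\<close>, and this covers the decrease of the right-hand side because \<open>a\<^sub>t \<ge> 1 / t\<close>.
\<close>

lemma sum_response_sq_le:
  assumes "0 < \<alpha>" "\<alpha> < 1"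
  shows "(\<Sum>s=1..t. (response \<alpha> s t)\<^sup>2) \<le> step_size 1 \<alpha> (Suc t) / (1 - \<alpha>)"
proof (induction t)
  case 0
  then show ?case using assms by (simp add: step_size_def)
next
  case (Suc t)
  define a where "a = step_size 1 \<alpha> (Suc t)"
  have a: "0 < a" "a \<le> 1" using step_size_1_bounds[of "Suc t" \<alpha>] assms by (auto simp: a_def)
  have "(\<Sum>s=1..Suc t. (response \<alpha> s (Suc t))\<^sup>2) = (1 - a)\<^sup>2 * (\<Sum>s=1..t. (response \<alpha> s t)\<^sup>2) + a\<^sup>2"
    by (simp add: response_Suc a_def power_mult_distrib sum_distrib_left)
  also have "\<dots> \<le> (1 - a)\<^sup>2 * (a / (1 - \<alpha>)) + a\<^sup>2"
    using Suc unfolding a_def[symmetric] by (intro add_right_mono mult_left_mono) auto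
  also have "\<dots> \<le> (1 - a) * (a / (1 - \<alpha>)) + a\<^sup>2"
    using a assms by (intro add_mono mult_right_mono) (auto simp: power2_eq_square mult_le_cancel_left2)
  also have "\<dots> = (a - \<alpha> * a * a) / (1 - \<alpha>)"
    using assms by (simp add: field_simps power2_eq_square)
  also have "\<dots> \<le> (a - \<alpha> * a * (1 / real (Suc t))) / (1 - \<alpha>)"
  proof -
    have "1 / real (Suc t) \<le> a"
      using powr_mono[of "-1" "-\<alpha>" "real (Suc t)"] assms
      by (simp add: a_def step_size_def powr_minus_divide del: of_nat_Suc)
    then show ?thesis using assms a by (intro divide_right_mono diff_left_mono mult_left_mono) auto
  qed
  also have "\<dots> = a * (1 - \<alpha> / real (Suc t)) / (1 - \<alpha>)" by (simp add: algebra_simps)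
  also have "\<dots> \<le> step_size 1 \<alpha> (Suc (Suc t)) / (1 - \<alpha>)"
    using step_size_decrement_le[of "Suc t" \<alpha>] assms
    by (intro divide_right_mono) (auto simp: a_def simp del: of_nat_Suc)
  finally show ?case .
qed

text \<open>
  The total response \<open>D s\<close> to a unit impulse satisfies the backward recursion
  \<open>D s = 1 + (1 - a\<^bsub>s+1\<^esub>) D (s + 1)\<close>. If the steps were constant its solution would be at most \<open>1 / a\<^sub>s\<close>, and the
  weight \<open>a\<^sub>s D s\<close> at most 1; since \<open>1 / a\<^sub>s\<close> grows by at most \<open>\<alpha> s powr (\<alpha> - 1)\<close> per step, the
  correction factor \<open>1 / (1 - \<alpha> s powr (\<alpha> - 1))\<close> suffices. It tends to 1.
\<close>

lemma weight_le:
  assumes "0 < \<alpha>" "\<alpha> < 1" "1 \<le> s" "s \<le> T"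
  shows "weight \<alpha> T s \<le> 1 / (1 - \<alpha> * real s powr (\<alpha> - 1))"
proof -
  define b where "b t = real t powr \<alpha>" for t :: nat
  define \<kappa> where "\<kappa> t = 1 - \<alpha> * real t powr (\<alpha> - 1)" for t :: nat
  define D where "D s = (\<Sum>t=s..T. \<Prod>j\<in>{s<..t}. 1 - step_size 1 \<alpha> j)" for s
  have ab: "step_size 1 \<alpha> t = 1 / b t" for t by (simp add: step_size_def b_def powr_minus_divide)
  have pow1: "real t powr (\<alpha> - 1) \<le> 1" if "t \<ge> 1" for t :: nat
    using powr_mono[of "\<alpha> - 1" 0 "real t"] that assms by simp
  have \<kappa>pos: "0 < \<kappa> t" if "t \<ge> 1" for t
  proof -
    have "\<alpha> * real t powr (\<alpha> - 1) \<le> \<alpha> * 1" using pow1[OF that] assms by (intro mult_left_mono) auto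
    also have "\<dots> < 1" using assms by simp
    finally show ?thesis using assms by (simp add: \<kappa>_def)
  qed
  have bge: "1 \<le> b t" if "t \<ge> 1" for t using that assms by (simp add: b_def ge_one_powr_ge_zero)
  have "1 \<le> s \<Longrightarrow> D s \<le> b s / \<kappa> s"
    using \<open>s \<le> T\<close>
  proof (induction s rule: inc_induct)
    case base
    have "\<kappa> T \<le> 1" using assms by (simp add: \<kappa>_def)
    then have "\<kappa> T \<le> b T" using bge[of T] base by simp
    then show ?case using \<kappa>pos[of T] base by (simp add: D_def)
  next
    case (step n)
    have "D n = 1 + (\<Sum>t=Suc n..T. \<Prod>j\<in>{n<..t}. 1 - step_size 1 \<alpha> j)"
      using step by (simp add: D_def sum.atLeast_Suc_atMost)
    also have "(\<Sum>t=Suc n..T. \<Prod>j\<in>{n<..t}. 1 - step_size 1 \<alpha> j) = (1 - step_size 1 \<alpha> (Suc n)) * D (Suc n)"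
    proof -
      have "{n<..t} = insert (Suc n) {Suc n<..t}" if "Suc n \<le> t" for t using that by auto
      then show ?thesis by (simp add: D_def sum_distrib_left)
    qed
    also have "1 + (1 - step_size 1 \<alpha> (Suc n)) * D (Suc n)
        \<le> 1 + (1 - step_size 1 \<alpha> (Suc n)) * (b (Suc n) / \<kappa> (Suc n))"
      using step step_size_1_bounds[of "Suc n" \<alpha>] assms by (intro add_left_mono mult_left_mono) auto
    also have "\<dots> = 1 + (b (Suc n) - 1) / \<kappa> (Suc n)"
      using bge[of "Suc n"] \<kappa>pos[of "Suc n"] by (simp add: ab field_simps)
    also have "\<dots> \<le> 1 + (b (Suc n) - 1) / \<kappa> n"
    proof -
      have "real (Suc n) powr (\<alpha> - 1) \<le> real n powr (\<alpha> - 1)"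
        using step assms by (intro powr_mono2') auto
      then have "\<kappa> n \<le> \<kappa> (Suc n)" using assms by (simp add: \<kappa>_def del: of_nat_Suc)
      then show ?thesis using bge[of "Suc n"] \<kappa>pos[of n] step by (intro add_left_mono divide_left_mono) auto
    qed
    also have "\<dots> \<le> 1 + (b n + (1 - \<kappa> n) - 1) / \<kappa> n"
      using powr_increment_le[of n \<alpha>] step assms \<kappa>pos[of n]
      by (intro add_left_mono divide_right_mono) (auto simp: b_def \<kappa>_def)
    also have "\<dots> = b n / \<kappa> n" using \<kappa>pos[of n] step by (simp add: field_simps)
    finally show ?case .
  qed
  then have "D s \<le> b s / \<kappa> s" using assms by simp
  moreover have "weight \<alpha> T s = D s / b s"
    by (simp add: weight_def response_def D_def sum_distrib_left ab sum_divide_distrib)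
  ultimately have "weight \<alpha> T s \<le> b s / \<kappa> s / b s"
    using bge[of s] assms by (simp only:) (intro divide_right_mono, auto)
  then show ?thesis using bge[of s] assms by (simp add: \<kappa>_def)
qed

text \<open>
  Later steps damp less than step \<open>s\<close>, so the response is at least a geometric series, which gives
  \<open>1 - (1 - a\<^sub>s)\<^sup>m\<close> for the remaining number \<open>m\<close> of steps. Once \<open>m\<close> reaches the relaxation time
  \<open>1 / a\<^sub>s = s powr \<alpha>\<close> this is at least \<open>1 - exp (- 1)\<close>.
\<close>

lemma weight_ge_half:
  assumes "0 < \<alpha>" "1 \<le> s" "s \<le> T" "real s powr \<alpha> \<le> real (Suc T - s)"
  shows "1 / 2 \<le> weight \<alpha> T s"
proof -
  define a where "a = step_size 1 \<alpha> s"
  have a: "0 < a" "a \<le> 1" using step_size_1_bounds[of s \<alpha>] assms by (auto simp: a_def)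
  have "(\<Sum>i<Suc T - s. (1 - a) ^ i) = (\<Sum>t=s..T. (1 - a) ^ (t - s))"
    by (rule sum.reindex_bij_witness[of _ "\<lambda>t. t - s" "\<lambda>i. i + s"]) auto
  also have "\<dots> \<le> (\<Sum>t=s..T. \<Prod>j\<in>{s<..t}. 1 - step_size 1 \<alpha> j)"
  proof (rule sum_mono)
    fix t assume "t \<in> {s..T}"
    have "(1 - a) ^ (t - s) = (\<Prod>j\<in>{s<..t}. 1 - a)" by simp
    also have "\<dots> \<le> (\<Prod>j\<in>{s<..t}. 1 - step_size 1 \<alpha> j)"
      using assms a by (intro prod_mono) (auto simp: a_def intro!: step_size_antimono)
    finally show "(1 - a) ^ (t - s) \<le> (\<Prod>j\<in>{s<..t}. 1 - step_size 1 \<alpha> j)" .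
  qed
  finally have "a * (\<Sum>i<Suc T - s. (1 - a) ^ i) \<le> weight \<alpha> T s"
    using a by (simp add: weight_def response_def sum_distrib_left[symmetric] a_def[symmetric])
  moreover have "a * (\<Sum>i<Suc T - s. (1 - a) ^ i) = 1 - (1 - a) ^ (Suc T - s)"
    using one_diff_power_eq[of "1 - a" "Suc T - s"] by simp
  moreover have "(1 - a) ^ (Suc T - s) \<le> 1 / 2"
  proof -
    have "(1 - a) ^ (Suc T - s) \<le> exp (- a) ^ (Suc T - s)"
      using a exp_ge_add_one_self[of "- a"] by (intro power_mono) auto
    also have "\<dots> = exp (- (a * real (Suc T - s)))" by (simp add: exp_of_nat_mult[symmetric] mult.commute)
    also have "\<dots> \<le> exp (- 1)"
    proof -
      have "a * real s powr \<alpha> = 1" using assms by (simp add: a_def step_size_def powr_minus_divide)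
      moreover have "a * real s powr \<alpha> \<le> a * real (Suc T - s)" using assms(4) a by (intro mult_left_mono) auto
      ultimately show ?thesis by (simp only: exp_le_cancel_iff neg_le_iff_le)
    qed
    also have "\<dots> \<le> 1 / 2" using exp_ge_add_one_self[of "1::real"] by (simp add: exp_minus field_simps)
    finally show ?thesis .
  qed
  ultimately show ?thesis by simp
qed

lemma sum_powr_le:
  assumes "0 < \<alpha>" "\<alpha> < 1"
  shows "(\<Sum>s=1..T. \<alpha> * real s powr (\<alpha> - 1)) \<le> real T powr \<alpha>"
proof (induction T)
  case (Suc T)
  have "real T powr \<alpha> = real (Suc T) powr \<alpha> * (real T / real (Suc T)) powr \<alpha>"
    by (simp add: powr_divide)
  also have "\<dots> = real (Suc T) powr \<alpha> * (1 + (- 1 / real (Suc T))) powr \<alpha>"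
    by (simp add: field_simps)
  also have "\<dots> \<le> real (Suc T) powr \<alpha> * (1 + \<alpha> * (- 1 / real (Suc T)))"
  proof (cases "T = 0")
    case True
    then show ?thesis using assms by simp
  next
    case False
    then show ?thesis using assms by (intro mult_left_mono bernoulli_powr) (auto simp: field_simps)
  qed
  also have "\<dots> = real (Suc T) powr \<alpha> - \<alpha> * real (Suc T) powr (\<alpha> - 1)"
    by (simp add: powr_diff algebra_simps)
  finally show ?case using Suc by simp
qed simp

text \<open>
  The excess of \<open>weight_le\<close> over 1 sums to \<open>O(T powr \<alpha>)\<close>, hence negligible against \<open>T\<close>: the variance
  of any initial part of the normalized sum is asymptotically at most 1.
\<close>

lemma sum_weight_sq_le:
  assumes "0 < \<alpha>" "\<alpha> < 1" "n \<le> T" "0 < T"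
  shows "(\<Sum>s=1..n. (weight \<alpha> T s / sqrt (real T))\<^sup>2) \<le> 1 + 2 / (1 - \<alpha>)\<^sup>2 * real T powr (\<alpha> - 1)"
proof -
  have sq: "(weight \<alpha> T s)\<^sup>2 \<le> 1 + 2 / (1 - \<alpha>)\<^sup>2 * (\<alpha> * real s powr (\<alpha> - 1))" if "s \<in> {1..n}" for s
  proof -
    define x where "x = \<alpha> * real s powr (\<alpha> - 1)"
    have "real s powr (\<alpha> - 1) \<le> 1" using powr_mono[of "\<alpha> - 1" 0 "real s"] that assms by simp
    then have x: "0 \<le> x" "x \<le> \<alpha>" using assms by (auto simp: x_def mult_le_cancel_left2)
    have w: "0 \<le> weight \<alpha> T s" using that assms by (intro weight_nonneg) auto
    have "(weight \<alpha> T s)\<^sup>2 \<le> (1 / (1 - x))\<^sup>2"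
      using weight_le[of \<alpha> s T] w that assms by (intro power_mono) (auto simp: x_def)
    also have "\<dots> = 1 + x * (2 - x) / (1 - x)\<^sup>2"
    proof -
      have "(1 - x)\<^sup>2 + x * (2 - x) = 1" by (simp add: power2_eq_square algebra_simps)
      moreover have "(1 - x)\<^sup>2 \<noteq> 0" using x assms by simp
      ultimately show ?thesis by (simp add: power_divide add_divide_eq_iff)
    qed
    also have "\<dots> \<le> 1 + x * 2 / (1 - \<alpha>)\<^sup>2"
      using x assms by (intro add_left_mono frac_le mult_left_mono power_mono) auto
    finally show ?thesis by (simp add: x_def mult_ac)
  qed
  have "(\<Sum>s=1..n. (weight \<alpha> T s / sqrt (real T))\<^sup>2) = (\<Sum>s=1..n. (weight \<alpha> T s)\<^sup>2) / real T"
    using assms by (simp add: power_divide sum_divide_distrib)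
  also have "\<dots> \<le> (\<Sum>s=1..n. 1 + 2 / (1 - \<alpha>)\<^sup>2 * (\<alpha> * real s powr (\<alpha> - 1))) / real T"
    using sq by (intro divide_right_mono sum_mono) auto
  also have "\<dots> \<le> (\<Sum>s=1..T. 1 + 2 / (1 - \<alpha>)\<^sup>2 * (\<alpha> * real s powr (\<alpha> - 1))) / real T"
    using assms by (intro divide_right_mono sum_mono2 add_nonneg_nonneg mult_nonneg_nonneg divide_nonneg_nonneg) auto
  also have "\<dots> = (real T + 2 / (1 - \<alpha>)\<^sup>2 * (\<Sum>s=1..T. \<alpha> * real s powr (\<alpha> - 1))) / real T"
    by (simp add: sum.distrib sum_distrib_left)
  also have "\<dots> \<le> (real T + 2 / (1 - \<alpha>)\<^sup>2 * real T powr \<alpha>) / real T"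
    using assms by (intro divide_right_mono add_left_mono mult_left_mono sum_powr_le) auto
  also have "\<dots> = 1 + 2 / (1 - \<alpha>)\<^sup>2 * real T powr (\<alpha> - 1)"
    using assms by (simp add: powr_diff field_simps)
  finally show ?thesis .
qed

section \<open>Independent Gaussian sequences\<close>

abbreviation std_gauss :: "real measure" where
  "std_gauss \<equiv> density lborel std_normal_density"

definition gauss_seq :: "(nat \<Rightarrow> real) measure" where
  "gauss_seq = PiM UNIV (\<lambda>_. std_gauss)"

interpretation gauss_seq: prob_space gauss_seq
  unfolding gauss_seq_def by (intro prob_space_PiM prob_space_normal_density) simp

lemma space_gauss_seq [simp]: "space gauss_seq = UNIV"
  by (simp add: gauss_seq_def space_PiM)

lemma sets_gauss_seq [measurable_cong]: "sets gauss_seq = sets (PiM UNIV (\<lambda>_. borel))"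
  unfolding gauss_seq_def by (intro sets_PiM_cong) auto

lemma distributed_coord: "distributed gauss_seq lborel (\<lambda>\<omega>. \<omega> i) std_normal_density"
proof -
  have "distr gauss_seq lborel (\<lambda>\<omega>. \<omega> i) = distr gauss_seq std_gauss (\<lambda>\<omega>. \<omega> i)"
    by (intro distr_cong) auto
  also have "\<dots> = std_gauss"
    unfolding gauss_seq_def by (rule distr_PiM_component) (auto intro: prob_space_normal_density)
  finally show ?thesis by (simp add: distributed_def)
qed

lemma indep_coords: "gauss_seq.indep_vars (\<lambda>_. borel) (\<lambda>i \<omega>. \<omega> i) UNIV"
proof -
  have d: "distr gauss_seq borel (\<lambda>\<omega>. \<omega> i) = std_gauss" for i
    using distributed_distr_eq_density[OF distributed_coord, of i]
    by (subst distr_cong[of gauss_seq gauss_seq borel lborel]) auto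
  have "distr gauss_seq (Pi\<^sub>M UNIV (\<lambda>_. borel)) (\<lambda>x. \<lambda>i\<in>UNIV. x i) = distr gauss_seq gauss_seq (\<lambda>x. x)"
    by (intro distr_cong) (auto simp: sets_gauss_seq)
  then show ?thesis
    by (subst gauss_seq.indep_vars_iff_distr_eq_PiM') (auto simp: d distr_id2 gauss_seq_def[symmetric])
qed

text \<open>
  Some coefficients may vanish; they are dropped before independent Gaussians are added, and the index
  \<open>i\<close> certifies that something is left.
\<close>

lemma distributed_lincomb:
  assumes "finite I" "i \<in> I" "c i \<noteq> 0"
  shows "distributed gauss_seq lborel (\<lambda>\<omega>. \<Sum>s\<in>I. c s * \<omega> s) (normal_density 0 (sqrt (\<Sum>s\<in>I. (c s)\<^sup>2)))"
proof -
  define J where "J = {s\<in>I. c s \<noteq> 0}"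
  have J: "finite J" "J \<noteq> {}" using assms by (auto simp: J_def)
  have "gauss_seq.indep_vars (\<lambda>_. borel) (\<lambda>s \<omega>. c s * \<omega> s) J"
    by (rule gauss_seq.indep_vars_compose2[OF gauss_seq.indep_vars_subset[OF indep_coords]]) auto
  then have "distributed gauss_seq lborel (\<lambda>\<omega>. \<Sum>s\<in>J. c s * \<omega> s) (normal_density (\<Sum>s\<in>J. 0) (sqrt (\<Sum>s\<in>J. \<bar>c s\<bar>\<^sup>2)))"
  proof (rule gauss_seq.sum_indep_normal[OF J])
    fix s assume "s \<in> J"
    then show "0 < \<bar>c s\<bar>" by (simp add: J_def)
    show "distributed gauss_seq lborel (\<lambda>\<omega>. c s * \<omega> s) (normal_density 0 \<bar>c s\<bar>)"
      using gauss_seq.normal_density_affine[OF distributed_coord, of "c s" 0] \<open>s \<in> J\<close> by (simp add: J_def)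
  qed
  moreover have "(\<Sum>s\<in>J. c s * \<omega> s) = (\<Sum>s\<in>I. c s * \<omega> s)" for \<omega>
    using assms by (intro sum.mono_neutral_left) (auto simp: J_def)
  moreover have "(\<Sum>s\<in>J. (c s)\<^sup>2) = (\<Sum>s\<in>I. (c s)\<^sup>2)"
    using assms by (intro sum.mono_neutral_left) (auto simp: J_def)
  ultimately show ?thesis by simp
qed

definition abs_moment :: "real \<Rightarrow> real" where
  "abs_moment r = (\<integral>x. std_normal_density x * \<bar>x\<bar> powr r \<partial>lborel)"

text \<open>
  Real exponents are dominated by natural ones: \<open>\<bar>x\<bar> powr r \<le> 1 + \<bar>x\<bar>\<^sup>k\<close> for \<open>k \<ge> r\<close>.
\<close>

lemma integrable_abs_moment:
  assumes "0 \<le> r"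
  shows "integrable lborel (\<lambda>x. std_normal_density x * \<bar>x\<bar> powr r)"
proof (rule Bochner_Integration.integrable_bound)
  define k where "k = nat \<lceil>r\<rceil>"
  show "integrable lborel (\<lambda>x. std_normal_density x + std_normal_density x * \<bar>x\<bar> ^ k)"
    by (intro Bochner_Integration.integrable_add integrable_std_normal_moment_abs) auto
  show "AE x in lborel. norm (std_normal_density x * \<bar>x\<bar> powr r)
      \<le> norm (std_normal_density x + std_normal_density x * \<bar>x\<bar> ^ k)"
  proof (intro AE_I2)
    fix x :: real
    have "\<bar>x\<bar> powr r \<le> 1 + \<bar>x\<bar> ^ k"
    proof (cases "\<bar>x\<bar> \<le> 1")
      case True
      then have "\<bar>x\<bar> powr r \<le> 1 powr r" using assms by (intro powr_mono2) auto
      then show ?thesis by (simp add: add_increasing2)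
    next
      case False
      then have "\<bar>x\<bar> powr r \<le> \<bar>x\<bar> powr real k" using assms by (intro powr_mono) (auto simp: k_def)
      also have "\<dots> = \<bar>x\<bar> ^ k" using False by (intro powr_realpow) auto
      finally show ?thesis by simp
    qed
    then have "std_normal_density x * \<bar>x\<bar> powr r \<le> std_normal_density x * (1 + \<bar>x\<bar> ^ k)"
      by (intro mult_left_mono) auto
    then show "norm (std_normal_density x * \<bar>x\<bar> powr r) \<le> norm (std_normal_density x + std_normal_density x * \<bar>x\<bar> ^ k)"
      by (simp add: abs_mult distrib_left)
  qed
qed auto

lemma nn_integral_abs_moment:
  assumes "0 \<le> r"
  shows "(\<integral>\<^sup>+x. ennreal (std_normal_density x) * ennreal (\<bar>x\<bar> powr r) \<partial>lborel) = ennreal (abs_moment r)"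
  unfolding abs_moment_def
  by (subst nn_integral_eq_integral[symmetric])
     (auto intro: integrable_abs_moment[OF assms] simp: ennreal_mult)

lemma abs_moment_nonneg: "0 \<le> abs_moment r"
  unfolding abs_moment_def by (intro integral_nonneg_AE) auto

lemma moment_lincomb:
  assumes "finite I" "0 < r"
  shows "(\<integral>\<^sup>+\<omega>. ennreal (\<bar>\<Sum>s\<in>I. c s * \<omega> s\<bar> powr r) \<partial>gauss_seq)
    = ennreal ((\<Sum>s\<in>I. (c s)\<^sup>2) powr (r / 2) * abs_moment r)"
proof (cases "\<exists>i\<in>I. c i \<noteq> 0")
  case False
  then show ?thesis using assms by simp
next
  case True
  then obtain i where i: "i \<in> I" "c i \<noteq> 0" by auto
  define \<sigma> where "\<sigma> = sqrt (\<Sum>s\<in>I. (c s)\<^sup>2)"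
  have \<sigma>: "0 < \<sigma>" unfolding \<sigma>_def using i assms by (auto intro!: sum_pos2[of I i])
  have "distributed gauss_seq lborel (\<lambda>\<omega>. ((\<Sum>s\<in>I. c s * \<omega> s) - 0) / \<sigma>) std_normal_density"
    using distributed_lincomb[where c = c and i = i, OF assms(1) i] gauss_seq.normal_standard_normal_convert[OF \<sigma>] by (simp add: \<sigma>_def)
  from distributed_nn_integral[OF this, of "\<lambda>x. ennreal (\<bar>x\<bar> powr r)"]
  have *: "(\<integral>\<^sup>+\<omega>. ennreal (\<bar>(\<Sum>s\<in>I. c s * \<omega> s) / \<sigma>\<bar> powr r) \<partial>gauss_seq) = ennreal (abs_moment r)"
    using assms by (simp add: nn_integral_abs_moment)
  have "(\<integral>\<^sup>+\<omega>. ennreal (\<bar>\<Sum>s\<in>I. c s * \<omega> s\<bar> powr r) \<partial>gauss_seq)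
     = (\<integral>\<^sup>+\<omega>. ennreal (\<sigma> powr r) * ennreal (\<bar>(\<Sum>s\<in>I. c s * \<omega> s) / \<sigma>\<bar> powr r) \<partial>gauss_seq)"
    using \<sigma> by (intro nn_integral_cong) (simp add: ennreal_mult[symmetric] powr_divide)
  also have "\<dots> = ennreal (\<sigma> powr r) * ennreal (abs_moment r)"
    by (subst nn_integral_cmult) (auto simp: * simp del: abs_divide)
  also have "\<sigma> powr r = (\<Sum>s\<in>I. (c s)\<^sup>2) powr (r / 2)"
    by (simp add: \<sigma>_def powr_half_sqrt[symmetric] powr_powr sum_nonneg)
  finally show ?thesis by (simp add: ennreal_mult abs_moment_nonneg)
qed

text \<open>
  The next two lemmas bound a normal density by its maximum from above and by its value at the farthest
  point of an interval from below. For intervals of width \<open>O(\<epsilon>)\<close> near 0 both are sharp to first order.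
\<close>

lemma (in prob_space) normal_prob_le:
  assumes "distributed M lborel X (normal_density \<mu> \<sigma>)" "0 < \<sigma>" "A \<in> sets borel" "A \<subseteq> {a..b}" "a \<le> b"
  shows "prob (X -` A \<inter> space M) \<le> (b - a) / (\<sigma> * sqrt (2 * pi))"
proof -
  have "emeasure M (X -` A \<inter> space M) = (\<integral>\<^sup>+x. ennreal (normal_density \<mu> \<sigma> x) * indicator A x \<partial>lborel)"
    using assms by (subst distributed_emeasure[OF assms(1)]) auto
  also have "\<dots> \<le> (\<integral>\<^sup>+x. ennreal (1 / (\<sigma> * sqrt (2 * pi))) * indicator {a..b} x \<partial>lborel)"
    using assms by (intro nn_integral_mono mult_mono)
      (auto simp: normal_density_def real_sqrt_mult field_simps indicator_def)
  also have "\<dots> = ennreal ((b - a) / (\<sigma> * sqrt (2 * pi)))"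
    using assms by (simp add: nn_integral_cmult_indicator ennreal_mult[symmetric])
  finally show ?thesis using assms by (simp add: emeasure_eq_measure)
qed

lemma (in prob_space) normal_prob_ge:
  assumes "distributed M lborel X (normal_density 0 \<sigma>)" "0 < \<sigma>" "A \<in> sets borel" "{a<..<b} \<subseteq> A" "a \<le> b"
    and "\<And>x. x \<in> {a<..<b} \<Longrightarrow> \<bar>x\<bar> \<le> r"
  shows "(b - a) / (\<sigma> * sqrt (2 * pi)) * exp (- r\<^sup>2 / (2 * \<sigma>\<^sup>2)) \<le> prob (X -` A \<inter> space M)"
proof -
  let ?d = "1 / (\<sigma> * sqrt (2 * pi)) * exp (- r\<^sup>2 / (2 * \<sigma>\<^sup>2))"
  have "ennreal ((b - a) / (\<sigma> * sqrt (2 * pi)) * exp (- r\<^sup>2 / (2 * \<sigma>\<^sup>2))) = (\<integral>\<^sup>+x. ennreal ?d * indicator {a<..<b} x \<partial>lborel)"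
    using assms by (simp add: nn_integral_cmult_indicator ennreal_mult[symmetric])
  also have "\<dots> \<le> (\<integral>\<^sup>+x. ennreal (normal_density 0 \<sigma> x) * indicator A x \<partial>lborel)"
  proof (intro nn_integral_mono)
    fix x
    have "?d \<le> normal_density 0 \<sigma> x" if "x \<in> {a<..<b}"
    proof -
      have "x\<^sup>2 \<le> r\<^sup>2" using assms(6)[OF that] by (meson abs_ge_zero abs_le_square_iff order_trans abs_of_nonneg order_refl abs_ge_self)
      then show ?thesis using assms(2)
        by (auto simp: normal_density_def real_sqrt_mult divide_right_mono mult_ac intro!: divide_right_mono)
    qed
    then show "ennreal ?d * indicator {a<..<b} x \<le> ennreal (normal_density 0 \<sigma> x) * indicator A x"
      using assms(4) by (auto simp: indicator_def)
  qed
  also have "\<dots> = emeasure M (X -` A \<inter> space M)"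
    using assms by (subst distributed_emeasure[OF assms(1)]) auto
  finally show ?thesis using assms by (simp add: emeasure_eq_measure)
qed

section \<open>The endpoint and polygonal paths in Skorokhod space\<close>

lemma time_change_1:
  assumes "l \<in> time_changes"
  shows "l 1 = 1"
proof -
  have "1 \<in> l ` {0..1}" "l 1 \<in> {0..1}"
    using assms unfolding time_changes_def bij_betw_def by fastforce+
  then obtain x where x: "x \<in> {0..1}" "l x = 1" "l 1 \<le> 1" by auto
  show ?thesis
  proof (cases "x = 1")
    case False
    then have "l x < l 1"
      using assms x strict_mono_onD[of "{0..1}" l x 1] unfolding time_changes_def by auto
    then show ?thesis using x by simp
  qed (use x in simp)
qed

lemma skorokhod_dist_ge_endpoint: "ereal \<bar>f 1 - h 1\<bar> \<le> skorokhod_dist f h"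
  unfolding skorokhod_dist_def
proof (rule INF_greatest)
  fix l assume "l \<in> time_changes"
  then have "ereal \<bar>f 1 - h 1\<bar> \<le> (SUP r\<in>{0..1}. ereal \<bar>f (l r) - h r\<bar>)"
    by (intro SUP_upper2[of 1]) (auto simp: time_change_1)
  then show "ereal \<bar>f 1 - h 1\<bar> \<le> max (SUP (s, t)\<in>{(s, t). 0 \<le> s \<and> s < t \<and> t \<le> 1}.
      ereal \<bar>ln ((l t - l s) / (t - s))\<bar>) (SUP r\<in>{0..1}. ereal \<bar>f (l r) - h r\<bar>)"
    by (simp add: le_max_iff_disj)
qed

lemma skorokhod_dist_le_uniform:
  assumes "\<And>r. r \<in> {0..1} \<Longrightarrow> \<bar>f r - h r\<bar> \<le> c"
  shows "skorokhod_dist f h \<le> ereal c"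
  unfolding skorokhod_dist_def
proof (rule INF_lower2)
  show "(\<lambda>x. x) \<in> time_changes"
    by (auto simp: time_changes_def strict_mono_on_def bij_betw_def)
  have "0 \<le> c" using assms[of 0] by simp
  then show "max (SUP (s, t)\<in>{(s, t). 0 \<le> s \<and> s < t \<and> t \<le> 1}. ereal \<bar>ln ((t - s) / (t - s))\<bar>)
      (SUP r\<in>{0..1}. ereal \<bar>f r - h r\<bar>) \<le> ereal c"
    using assms by (auto intro!: SUP_least)
qed

lemma endpoint_ball_in_borel: "{f \<in> cadlag_space. \<bar>f 1\<bar> < c} \<in> sets skorokhod_borel"
proof -
  have "skorokhod_open {f \<in> cadlag_space. \<bar>f 1\<bar> < c}"
    unfolding skorokhod_open_def
  proof (intro conjI ballI)
    fix f assume f: "f \<in> {f \<in> cadlag_space. \<bar>f 1\<bar> < c}"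
    show "\<exists>r>0. \<forall>h\<in>cadlag_space. skorokhod_dist f h < ereal r \<longrightarrow> h \<in> {f \<in> cadlag_space. \<bar>f 1\<bar> < c}"
    proof (intro exI[of _ "c - \<bar>f 1\<bar>"] conjI ballI impI)
      fix h assume h: "h \<in> cadlag_space" "skorokhod_dist f h < ereal (c - \<bar>f 1\<bar>)"
      then have "ereal \<bar>f 1 - h 1\<bar> < ereal (c - \<bar>f 1\<bar>)"
        using skorokhod_dist_ge_endpoint[of f h] by (rule_tac le_less_trans)
      then show "h \<in> {f \<in> cadlag_space. \<bar>f 1\<bar> < c}" using h by auto
    qed (use f in auto)
  qed auto
  then show ?thesis
    unfolding skorokhod_borel_def by (intro in_measure_of) (auto simp: skorokhod_open_def)
qed

lemma nbhd_endpoint_ball_subset: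
  "skorokhod_nbhd {f \<in> cadlag_space. \<bar>f 1\<bar> < c} \<delta> \<subseteq> {h. \<bar>h 1\<bar> < c + \<delta>}"
proof
  fix h assume "h \<in> skorokhod_nbhd {f \<in> cadlag_space. \<bar>f 1\<bar> < c} \<delta>"
  then obtain f where f: "\<bar>f 1\<bar> < c" "skorokhod_dist f h < ereal \<delta>"
    unfolding skorokhod_nbhd_def INF_less_iff by auto
  then have "\<bar>f 1 - h 1\<bar> < \<delta>"
    using skorokhod_dist_ge_endpoint[of f h] by (metis ereal_less(2) le_less_trans less_ereal.simps(1))
  then show "h \<in> {h. \<bar>h 1\<bar> < c + \<delta>}" using f by auto
qed

text \<open>
  A set receives from \<open>distr\<close> the measure of its preimage or, where the image measure does not exist, the
  value 0. Either way a measurable set that contains the preimage gives an upper bound.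
\<close>

lemma measure_distr_le:
  assumes "finite_measure M" "f -` A \<inter> space M \<subseteq> B" "B \<in> sets M"
  shows "measure (distr M N f) A \<le> measure M B"
proof -
  interpret finite_measure M by fact
  have "emeasure (distr M N f) A \<le> emeasure M (f -` A \<inter> space M)"
    unfolding distr_def emeasure_measure_of_conv by simp
  also have "\<dots> \<le> emeasure M B" using assms by (intro emeasure_mono)
  finally show ?thesis unfolding measure_def by (intro enn2real_mono) (auto simp: less_top[symmetric])
qed

text \<open>
  The weight of the \<open>t\<close>-th increment is the fraction of the interval \<open>[(t - 1) / T, t / T]\<close> that lies to the
  left of \<open>r\<close>. In this form continuity in \<open>r\<close> and in the increments is visible, which the definition with
  the integer part hides.
\<close>

definition polygonal_path :: "nat \<Rightarrow> (nat \<Rightarrow> real) \<Rightarrow> real \<Rightarrow> real" where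
  "polygonal_path T x = (\<lambda>r\<in>{0..1}.
     (\<Sum>t=1..T. max 0 (min 1 (real T * r - real (t - 1))) * x t) / sqrt (real T))"

lemma sa_path_eq_polygonal:
  "sa_path step T M \<omega> = polygonal_path T (\<lambda>t. iterate step M (t + 1) \<omega>)"
proof (cases "T = 0")
  case True
  then show ?thesis by (auto simp: sa_path_def polygonal_path_def fun_eq_iff)
next
  case False
  show ?thesis
  proof
    fix r :: real
    show "sa_path step T M \<omega> r = polygonal_path T (\<lambda>t. iterate step M (t + 1) \<omega>) r"
    proof (cases "r \<in> {0..1}")
      case r: True
      define n where "n = nat \<lfloor>real T * r\<rfloor>"
      define x where "x t = iterate step M (t + 1) \<omega>" for t
      define w where "w t = max 0 (min 1 (real T * r - real (t - 1)))" for t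
      have n: "real n \<le> real T * r" "real T * r < real n + 1" using r by (auto simp: n_def)
      have w: "w t = (if t \<le> n then 1 else if t = Suc n then real T * r - real n else 0)" if "t \<ge> 1" for t
      proof -
        consider "t \<le> n" | "t = Suc n" | "n + 2 \<le> t" by linarith
        then show ?thesis
        proof cases
          case 1
          then have "real (t - 1) \<le> real n - 1" using that by simp
          then show ?thesis using 1 n by (simp add: w_def)
        next
          case 2
          then show ?thesis using n by (simp add: w_def)
        next
          case 3
          then have "real n + 1 \<le> real (t - 1)" by simp
          then show ?thesis using 3 n by (simp add: w_def)
        qed
      qed
      have Tr: "real T * r \<le> real T" using r by (simp add: mult_left_le)
      then have nT: "n \<le> T" using n by linarith
      have "(\<Sum>t=1..T. w t * x t) = (\<Sum>t=1..n. x t) + (real T * r - real n) * x (Suc n)"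
      proof (cases "n = T")
        case True
        have "(\<Sum>t=1..T. w t * x t) = (\<Sum>t=1..n. x t)"
          unfolding True[symmetric] by (intro sum.cong) (auto simp: w)
        then show ?thesis using True n Tr by simp
      next
        case False
        then have "(\<Sum>t=1..T. w t * x t) = (\<Sum>t=1..Suc n. w t * x t)"
          using nT by (intro sum.mono_neutral_right) (auto simp: w)
        also have "\<dots> = (\<Sum>t=1..n. w t * x t) + w (Suc n) * x (Suc n)" by simp
        also have "(\<Sum>t=1..n. w t * x t) = (\<Sum>t=1..n. x t)" by (intro sum.cong) (auto simp: w)
        finally show ?thesis by (simp add: w)
      qed
      then show ?thesis
        using r by (simp add: sa_path_def polygonal_path_def n_def x_def w_def Let_def)
    qed (simp add: sa_path_def polygonal_path_def del: atLeastAtMost_iff)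
  qed
qed

lemma polygonal_path_cadlag: "polygonal_path T x \<in> cadlag_space"
proof -
  define F where "F r = (\<Sum>t=1..T. max 0 (min 1 (real T * r - real (t - 1))) * x t) / sqrt (real T)" for r :: real
  have F: "continuous_on UNIV F" unfolding F_def by (cases "T = 0") (auto intro!: continuous_intros)
  have Fx: "polygonal_path T x r = F r" if "r \<in> {0..1}" for r using that by (simp add: polygonal_path_def F_def)
  have lim: "(F \<longlongrightarrow> F t) (at t within A)" for t A
    using F by (metis UNIV_I continuous_on_def tendsto_within_subset top_greatest)
  have "(polygonal_path T x \<longlongrightarrow> polygonal_path T x t) (at_right t)" if "t \<in> {0..<1}" for t
  proof -
    have "\<forall>\<^sub>F r in at_right t. F r = polygonal_path T x r"
      using that by (auto simp: eventually_at_right_field Fx intro!: exI[of _ 1])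
    then have "(polygonal_path T x \<longlongrightarrow> F t) (at_right t)"
      by (rule Lim_transform_eventually[OF lim])
    then show ?thesis using that by (simp add: Fx)
  qed
  moreover have "\<exists>l. (polygonal_path T x \<longlongrightarrow> l) (at_left t)" if "t \<in> {0<..1}" for t
  proof (intro exI, rule Lim_transform_eventually[OF lim])
    show "\<forall>\<^sub>F r in at_left t. F r = polygonal_path T x r"
      using that by (auto simp: eventually_at_left_field Fx intro!: exI[of _ 0])
  qed
  ultimately show ?thesis by (auto simp: cadlag_space_def polygonal_path_def)
qed

lemma polygonal_path_dist:
  assumes "r \<in> {0..1}" "T \<ge> 1"
  shows "\<bar>polygonal_path T x r - polygonal_path T y r\<bar> \<le> (\<Sum>t=1..T. \<bar>x t - y t\<bar>)"
proof -
  define w where "w t = max 0 (min 1 (real T * r - real (t - 1)))" for t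
  have "\<bar>polygonal_path T x r - polygonal_path T y r\<bar> = \<bar>\<Sum>t=1..T. w t * (x t - y t)\<bar> / sqrt (real T)"
    using assms by (simp add: polygonal_path_def w_def right_diff_distrib sum_subtractf diff_divide_distrib[symmetric])
  also have "\<dots> \<le> \<bar>\<Sum>t=1..T. w t * (x t - y t)\<bar>"
    using assms by (simp add: divide_le_eq mult_le_cancel_left1)
  also have "\<dots> \<le> (\<Sum>t=1..T. \<bar>w t * (x t - y t)\<bar>)" by (rule sum_abs)
  also have "\<dots> \<le> (\<Sum>t=1..T. \<bar>x t - y t\<bar>)"
    by (intro sum_mono) (auto simp: abs_mult w_def intro!: mult_left_le_one_le)
  finally show ?thesis .
qed

text \<open>
  As a function of finitely many increments, the polygonal path is continuous for the uniform distance,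
  hence for the Skorokhod distance. Preimages of open sets are therefore open in the product topology on
  sequences, and the Borel sets of that topology form the product \<open>\<sigma>\<close>-algebra.
\<close>

lemma polygonal_path_measurable:
  assumes "T \<ge> 1" "\<And>t. X t \<in> borel_measurable M"
  shows "(\<lambda>\<omega>. polygonal_path T (\<lambda>t. X t \<omega>)) \<in> measurable M skorokhod_borel"
proof -
  have "polygonal_path T \<in> measurable (PiM UNIV (\<lambda>_. borel)) skorokhod_borel"
    unfolding skorokhod_borel_def
  proof (rule measurable_measure_of)
    fix U assume U: "U \<in> {U. skorokhod_open U}"
    have "open (polygonal_path T -` U)"
    proof (subst open_subopen, intro ballI)
      fix x assume x: "x \<in> polygonal_path T -` U"
      then obtain r where r: "r > 0"
        "\<And>h. h \<in> cadlag_space \<Longrightarrow> skorokhod_dist (polygonal_path T x) h < ereal r \<Longrightarrow> h \<in> U"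
        using U by (auto simp: skorokhod_open_def)
      \<comment> \<open>Each of the \<open>T\<close> increments may move by \<open>d\<close>; in total the path moves by at most \<open>r / 2\<close>.\<close>
      define d where "d = r / (2 * real T)"
      have d: "0 < d" using r assms by (simp add: d_def)
      define V where "V = {y :: nat \<Rightarrow> real. \<forall>t\<in>{1..T}. y (id t) \<in> {x t - d<..<x t + d}}"
      have "open V" unfolding V_def by (rule product_topology_basis') auto
      moreover have "x \<in> V" using d by (simp add: V_def)
      moreover have "V \<subseteq> polygonal_path T -` U"
      proof
        fix y assume y: "y \<in> V"
        have "(\<Sum>t=1..T. \<bar>x t - y t\<bar>) \<le> (\<Sum>t=1..T. d)"
          using y by (intro sum_mono) (auto simp: V_def abs_le_iff less_imp_le field_simps)
        also have "\<dots> = r / 2" using assms by (simp add: d_def)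
        finally have "skorokhod_dist (polygonal_path T x) (polygonal_path T y) \<le> ereal (r / 2)"
          using assms by (intro skorokhod_dist_le_uniform order_trans[OF polygonal_path_dist]) auto
        also have "\<dots> < ereal r" using r by simp
        finally show "y \<in> polygonal_path T -` U" using r polygonal_path_cadlag by auto
      qed
      ultimately show "\<exists>V. open V \<and> x \<in> V \<and> V \<subseteq> polygonal_path T -` U" by blast
    qed
    then have "polygonal_path T -` U \<in> sets (PiM UNIV (\<lambda>_. borel))"
      by (simp add: sets_PiM_equal_borel)
    then show "polygonal_path T -` U \<inter> space (PiM UNIV (\<lambda>_. borel)) \<in> sets (PiM UNIV (\<lambda>_. borel))"
      by (simp add: space_PiM)
  qed (auto simp: skorokhod_open_def polygonal_path_cadlag)
  moreover have "(\<lambda>\<omega> t. X t \<omega>) \<in> measurable M (PiM UNIV (\<lambda>_. borel))"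
    using assms by (intro measurable_PiM_single') (auto simp: space_PiM)
  ultimately show ?thesis by (rule measurable_compose[rotated])
qed

section \<open>Conditioning on the past coordinates\<close>

text \<open>
  Pulling back the product \<open>\<sigma>\<close>-algebra along the restriction map makes every event of the past a
  cylinder over the first coordinates, so that independence of the next coordinate is inherited directly
  from independence of disjoint blocks.
\<close>

definition past :: "nat \<Rightarrow> (nat \<Rightarrow> real) measure" where
  "past t = vimage_algebra UNIV (\<lambda>\<omega>. restrict \<omega> {..t}) (PiM {..t} (\<lambda>_. borel))"

lemma space_past [simp]: "space (past t) = UNIV"
  by (simp add: past_def)

lemma sets_past: "sets (past t) = {(\<lambda>\<omega>. restrict \<omega> {..t}) -` A | A. A \<in> sets (PiM {..t} (\<lambda>_. borel))}"
  unfolding past_def by (subst sets_vimage_algebra2) (auto simp: space_PiM)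

lemma measurable_coord_past:
  assumes "i \<le> t"
  shows "(\<lambda>\<omega>. \<omega> i) \<in> borel_measurable (past t)"
proof -
  have "(\<lambda>\<omega>. restrict \<omega> {..t}) \<in> measurable (past t) (PiM {..t} (\<lambda>_. borel))"
    unfolding past_def by (rule measurable_vimage_algebra1) (auto simp: space_PiM)
  then have "(\<lambda>\<omega>. restrict \<omega> {..t} i) \<in> borel_measurable (past t)"
    by (rule measurable_compose[OF _ measurable_component_singleton]) (use assms in simp)
  then show ?thesis using assms by simp
qed

lemma past_subset:
  assumes "space N = UNIV" "\<And>i. i \<le> t \<Longrightarrow> (\<lambda>\<omega>. \<omega> i) \<in> borel_measurable N"
  shows "sets (past t) \<subseteq> sets N"
  unfolding past_def
  by (rule sets_image_in_sets) (use assms in \<open>auto intro!: measurable_restrict\<close>)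

lemma subalgebra_past: "subalgebra gauss_seq (past t)"
proof -
  have "sets (past t) \<subseteq> sets gauss_seq" by (rule past_subset) simp_all
  then show ?thesis by (simp add: subalgebra_def)
qed

lemma filtration_past: "filtration UNIV past"
proof
  fix i j :: nat assume "i \<le> j"
  then show "sets (past i) \<subseteq> sets (past j)"
    by (intro past_subset measurable_coord_past) auto
qed simp

lemma sigma_finite_subalgebra_past: "sigma_finite_subalgebra gauss_seq (past t)"
  by (intro finite_measure_subalgebra_is_sigma_finite finite_measure_subalgebra.intro
      finite_measure_subalgebra_axioms.intro gauss_seq.finite_measure_axioms subalgebra_past)

text \<open>
  Both components have to be random variables of the same type, so the next coordinate appears as a
  sequence indexed by a singleton.
\<close>

lemma indep_past_next:
  "gauss_seq.indep_var (past t) (\<lambda>\<omega>. \<omega>) (PiM {Suc t} (\<lambda>_. borel)) (\<lambda>\<omega>. restrict \<omega> {Suc t})"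
proof -
  have *: "gauss_seq.indep_var (PiM {..t} (\<lambda>_. borel)) (\<lambda>\<omega>. restrict (\<lambda>i. \<omega> i) {..t})
      (PiM {Suc t} (\<lambda>_. borel)) (\<lambda>\<omega>. restrict (\<lambda>i. \<omega> i) {Suc t})"
    by (rule gauss_seq.indep_var_restrict[OF indep_coords]) auto
  have "{(\<lambda>\<omega>. \<omega>) -` A \<inter> space gauss_seq | A. A \<in> sets (past t)}
      = {(\<lambda>\<omega>. restrict \<omega> {..t}) -` A \<inter> space gauss_seq | A. A \<in> sets (PiM {..t} (\<lambda>_. borel))}"
    by (auto simp: sets_past)
  moreover have "(\<lambda>\<omega>. \<omega>) \<in> measurable gauss_seq (past t)"
    using subalgebra_past[of t] by (auto simp: subalgebra_def measurable_def)
  ultimately show ?thesis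
    using * unfolding gauss_seq.indep_var_eq by simp
qed

lemma indep_past_next_compose:
  assumes "f \<in> measurable (past t) A" "h \<in> measurable borel B"
  shows "gauss_seq.indep_var A f B (\<lambda>\<omega>. h (\<omega> (Suc t)))"
proof -
  have "(\<lambda>x. h (x (Suc t))) \<in> measurable (PiM {Suc t} (\<lambda>_. borel)) B"
    by (rule measurable_compose[OF measurable_component_singleton[of "Suc t" "{Suc t}" "\<lambda>_. borel"] assms(2)])
       (rule singletonI)
  from gauss_seq.indep_var_compose[OF indep_past_next assms(1) this] show ?thesis by (simp add: comp_def)
qed

lemma nn_cond_exp_past:
  fixes f :: "(nat \<Rightarrow> real) \<Rightarrow> ennreal" and h :: "real \<Rightarrow> ennreal"
  assumes f: "f \<in> borel_measurable (past t)" and h [measurable]: "h \<in> borel_measurable borel"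
  shows "AE \<omega> in gauss_seq. nn_cond_exp gauss_seq (past t) (\<lambda>\<omega>. f \<omega> * h (\<omega> (Suc t))) \<omega>
    = f \<omega> * (\<integral>\<^sup>+x. ennreal (std_normal_density x) * h x \<partial>lborel)"
proof -
  interpret past: sigma_finite_subalgebra gauss_seq "past t" by (rule sigma_finite_subalgebra_past)
  define c where "c = (\<integral>\<^sup>+x. ennreal (std_normal_density x) * h x \<partial>lborel)"
  have fm [measurable]: "f \<in> borel_measurable gauss_seq"
    using measurable_from_subalg[OF subalgebra_past f] .
  have c: "(\<integral>\<^sup>+\<omega>. h (\<omega> (Suc t)) \<partial>gauss_seq) = c"
    using distributed_nn_integral[OF distributed_coord, of h "Suc t"] by (simp add: c_def)
  have "AE \<omega> in gauss_seq. f \<omega> * c = nn_cond_exp gauss_seq (past t) (\<lambda>\<omega>. f \<omega> * h (\<omega> (Suc t))) \<omega>"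
  proof (rule past.nn_cond_exp_charact)
    fix A assume A: "A \<in> sets (past t)"
    then have [measurable]: "A \<in> sets gauss_seq" using subalgebra_past by (auto simp: subalgebra_def)
    define g where "g b \<omega> = (if b then f \<omega> * indicator A \<omega> else h (\<omega> (Suc t)))" for b \<omega>
    have "gauss_seq.indep_var borel (\<lambda>\<omega>. f \<omega> * indicator A \<omega>) borel (\<lambda>\<omega>. h (\<omega> (Suc t)))"
      using A f by (intro indep_past_next_compose) auto
    then have "gauss_seq.indep_vars (\<lambda>_. borel) g UNIV"
      unfolding gauss_seq.indep_var_def g_def[abs_def]
      by (rule gauss_seq.indep_vars_cong[THEN iffD1, rotated -1]) (auto split: bool.split)
    then have "(\<integral>\<^sup>+\<omega>. (\<Prod>b\<in>UNIV. g b \<omega>) \<partial>gauss_seq) = (\<Prod>b\<in>UNIV. \<integral>\<^sup>+\<omega>. g b \<omega> \<partial>gauss_seq)"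
      by (intro gauss_seq.indep_vars_nn_integral) auto
    then have "(\<integral>\<^sup>+\<omega>. f \<omega> * indicator A \<omega> * h (\<omega> (Suc t)) \<partial>gauss_seq)
        = (\<integral>\<^sup>+\<omega>. f \<omega> * indicator A \<omega> \<partial>gauss_seq) * c"
      by (simp add: UNIV_bool g_def c mult_ac)
    also have "\<dots> = (\<integral>\<^sup>+\<omega>. f \<omega> * indicator A \<omega> * c \<partial>gauss_seq)"
      by (rule nn_integral_multc[symmetric]) simp
    finally show "(\<integral>\<^sup>+\<omega>\<in>A. (f \<omega> * h (\<omega> (Suc t))) \<partial>gauss_seq) = (\<integral>\<^sup>+\<omega>\<in>A. (f \<omega> * c) \<partial>gauss_seq)"
      by (simp add: mult_ac)
  qed (use f in auto)
  then show ?thesis by (auto simp: c_def)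
qed

lemma real_cond_exp_past:
  fixes f :: "(nat \<Rightarrow> real) \<Rightarrow> real" and h :: "real \<Rightarrow> real"
  assumes f: "f \<in> borel_measurable (past t)" and bounded: "\<And>\<omega>. \<bar>f \<omega>\<bar> \<le> 1"
    and h [measurable]: "h \<in> borel_measurable borel"
    and int: "integrable lborel (\<lambda>x. std_normal_density x * h x)"
  shows "integrable gauss_seq (\<lambda>\<omega>. f \<omega> * h (\<omega> (Suc t)))"
    and "AE \<omega> in gauss_seq. real_cond_exp gauss_seq (past t) (\<lambda>\<omega>. f \<omega> * h (\<omega> (Suc t))) \<omega>
    = f \<omega> * (\<integral>x. std_normal_density x * h x \<partial>lborel)"
proof -
  interpret past: sigma_finite_subalgebra gauss_seq "past t" by (rule sigma_finite_subalgebra_past)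
  define c where "c = (\<integral>x. std_normal_density x * h x \<partial>lborel)"
  have [measurable]: "f \<in> borel_measurable gauss_seq"
    using measurable_from_subalg[OF subalgebra_past f] .
  have c: "(\<integral>\<omega>. h (\<omega> (Suc t)) \<partial>gauss_seq) = c"
    using distributed_integral[OF distributed_coord, of h "Suc t"] by (simp add: c_def)
  have hi: "integrable gauss_seq (\<lambda>\<omega>. h (\<omega> (Suc t)))"
    using distributed_integrable[OF distributed_coord, of h "Suc t"] int by simp
  show fh: "integrable gauss_seq (\<lambda>\<omega>. f \<omega> * h (\<omega> (Suc t)))"
    by (rule Bochner_Integration.integrable_bound[OF hi])
       (auto simp: abs_mult bounded intro!: mult_left_le_one_le)
  have "AE \<omega> in gauss_seq. real_cond_exp gauss_seq (past t) (\<lambda>\<omega>. h (\<omega> (Suc t))) \<omega> = c"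
  proof (rule past.real_cond_exp_charact)
    fix A assume A: "A \<in> sets (past t)"
    then have [measurable]: "A \<in> sets gauss_seq" using subalgebra_past by (auto simp: subalgebra_def)
    have ind: "gauss_seq.indep_var borel (\<lambda>\<omega>. indicator A \<omega> :: real) borel (\<lambda>\<omega>. h (\<omega> (Suc t)))"
      using A by (intro indep_past_next_compose) auto
    have "integrable gauss_seq (\<lambda>\<omega>. indicator A \<omega> :: real)"
      by (simp add: less_top[symmetric])
    then have "(\<integral>\<omega>. indicator A \<omega> * h (\<omega> (Suc t)) \<partial>gauss_seq) = (\<integral>\<omega>. indicator A \<omega> \<partial>gauss_seq) * c"
      using gauss_seq.indep_var_lebesgue_integral[OF ind _ hi] unfolding c by blast
    then show "(LINT \<omega>:A|gauss_seq. h (\<omega> (Suc t))) = (LINT \<omega>:A|gauss_seq. c)"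
      by (simp add: set_lebesgue_integral_def c)
  qed (use hi in auto)
  moreover have "AE \<omega> in gauss_seq. real_cond_exp gauss_seq (past t) (\<lambda>\<omega>. f \<omega> * h (\<omega> (Suc t))) \<omega>
      = f \<omega> * real_cond_exp gauss_seq (past t) (\<lambda>\<omega>. h (\<omega> (Suc t))) \<omega>"
    by (rule past.real_cond_exp_mult) (use f fh in auto)
  ultimately show "AE \<omega> in gauss_seq. real_cond_exp gauss_seq (past t) (\<lambda>\<omega>. f \<omega> * h (\<omega> (Suc t))) \<omega>
    = f \<omega> * (\<integral>x. std_normal_density x * h x \<partial>lborel)"
    by eventually_elim (simp add: c_def)
qed

section \<open>Oracles that freeze near the target\<close>

definition near_zero :: "nat \<Rightarrow> (nat \<Rightarrow> real) \<Rightarrow> real \<Rightarrow> (nat \<Rightarrow> real) set" where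
  "near_zero n c \<epsilon> = {\<omega>. \<bar>\<Sum>s=1..n. c s * \<omega> s\<bar> < \<epsilon>}"

definition gate :: "nat \<Rightarrow> nat \<Rightarrow> (nat \<Rightarrow> real) \<Rightarrow> real \<Rightarrow> nat \<Rightarrow> (nat \<Rightarrow> real) \<Rightarrow> real" where
  "gate n T c \<epsilon> t \<omega> = (if t \<in> {n<..T} \<and> \<omega> \<in> near_zero n c \<epsilon> then 0 else 1)"

text \<open>
  The switch is decided at time \<open>n\<close> and acts on the noise at the times \<open>n + 1, \<dots>, T\<close>. After \<open>T\<close> the noise
  returns, so that the average conditional variance still tends to 1 as the number of steps grows.
\<close>

definition freezing_oracle ::
    "real \<Rightarrow> nat \<Rightarrow> nat \<Rightarrow> (nat \<Rightarrow> real) \<Rightarrow> real \<Rightarrow> (nat \<Rightarrow> real) sa_oracle" where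
  "freezing_oracle \<eta> n T c \<epsilon> =
     \<lparr>mean_field = \<lambda>x. x / \<eta>, noise = \<lambda>t \<omega>. gate n T c \<epsilon> t \<omega> * \<omega> t, filt = past, law = gauss_seq\<rparr>"

lemma freezing_oracle_sel [simp]:
  "mean_field (freezing_oracle \<eta> n T c \<epsilon>) = (\<lambda>x. x / \<eta>)"
  "noise (freezing_oracle \<eta> n T c \<epsilon>) = (\<lambda>t \<omega>. gate n T c \<epsilon> t \<omega> * \<omega> t)"
  "filt (freezing_oracle \<eta> n T c \<epsilon>) = past"
  "law (freezing_oracle \<eta> n T c \<epsilon>) = gauss_seq"
  by (simp_all add: freezing_oracle_def)

lemma near_zero_past: "near_zero n c \<epsilon> \<in> sets (past n)"
proof -
  have [measurable]: "(\<lambda>\<omega>. \<omega> s) \<in> borel_measurable (past n)" if "s \<in> {1..n}" for s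
    using that by (intro measurable_coord_past) auto
  have "{\<omega> \<in> space (past n). \<bar>\<Sum>s=1..n. c s * \<omega> s\<bar> < \<epsilon>} \<in> sets (past n)" by measurable
  then show ?thesis by (simp add: near_zero_def)
qed

lemma near_zero_sets [measurable]: "near_zero n c \<epsilon> \<in> sets gauss_seq"
  using near_zero_past[of n c \<epsilon>] subalgebra_past[of n] unfolding subalgebra_def by (auto dest: subsetD)

text \<open>
  The gate at time \<open>t + 1\<close> is constant unless \<open>n < t + 1\<close>, and then the decision taken at time \<open>n\<close> is known.
\<close>

lemma gate_predictable: "gate n T c \<epsilon> (Suc t) \<in> borel_measurable (past t)"
proof (cases "Suc t \<in> {n<..T}")
  case True
  then have "sets (past n) \<subseteq> sets (past t)" by (intro filtration.sets_F_mono[OF filtration_past]) auto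
  then have [measurable]: "near_zero n c \<epsilon> \<in> sets (past t)" using near_zero_past by auto
  show ?thesis unfolding gate_def[abs_def] by measurable
next
  case False
  then have "gate n T c \<epsilon> (Suc t) = (\<lambda>_. 1)" 
    by (intro ext) (simp only: gate_def simp_thms if_False)
  then show ?thesis by simp
qed

lemma abs_gate_le_1: "\<bar>gate n T c \<epsilon> t \<omega>\<bar> \<le> 1"
  by (simp add: gate_def)

lemma noise_cond_exp_0:
  shows "integrable gauss_seq (\<lambda>\<omega>. gate n T c \<epsilon> (Suc t) \<omega> * \<omega> (Suc t))"
    and "AE \<omega> in gauss_seq. real_cond_exp gauss_seq (past t) (\<lambda>\<omega>. gate n T c \<epsilon> (Suc t) \<omega> * \<omega> (Suc t)) \<omega> = 0"
proof -
  have int: "integrable lborel (\<lambda>x. std_normal_density x * x)"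
    using integrable_std_normal_moment[of 1] by simp
  have mean: "(\<integral>x. std_normal_density x * x \<partial>lborel) = 0"
    using integral_std_normal_moment_odd[of 0] by simp
  note * = real_cond_exp_past[OF gate_predictable[of n T c \<epsilon> t] abs_gate_le_1 measurable_ident_sets[OF refl] int]
  show "integrable gauss_seq (\<lambda>\<omega>. gate n T c \<epsilon> (Suc t) \<omega> * \<omega> (Suc t))" by (rule *(1))
  show "AE \<omega> in gauss_seq. real_cond_exp gauss_seq (past t) (\<lambda>\<omega>. gate n T c \<epsilon> (Suc t) \<omega> * \<omega> (Suc t)) \<omega> = 0"
    using *(2) unfolding mean mult_zero_right .
qed

text \<open>
  The gate is 0 or 1, hence equal to its square.
\<close>

lemma noise_cond_variance:
  "AE \<omega> in gauss_seq. real_cond_exp gauss_seq (past t) (\<lambda>\<omega>. (gate n T c \<epsilon> (Suc t) \<omega> * \<omega> (Suc t))\<^sup>2) \<omega>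
     = gate n T c \<epsilon> (Suc t) \<omega>"
proof -
  have "(\<lambda>\<omega>. (gate n T c \<epsilon> (Suc t) \<omega> * \<omega> (Suc t))\<^sup>2) = (\<lambda>\<omega>. gate n T c \<epsilon> (Suc t) \<omega> * (\<omega> (Suc t))\<^sup>2)"
    by (intro ext) (simp add: gate_def)
  moreover have var: "(\<integral>x. std_normal_density x * x\<^sup>2 \<partial>lborel) = 1"
    using integral_std_normal_moment_even[of 1] by (simp add: fact_numeral)
  moreover have "(\<lambda>x. x\<^sup>2) \<in> borel_measurable (borel :: real measure)" by measurable
  note real_cond_exp_past(2)[OF gate_predictable[of n T c \<epsilon> t] abs_gate_le_1 this integrable_std_normal_moment[of 2]]
  ultimately show ?thesis by simp
qed

lemma stochastic_oracle_freezing: "stochastic_oracle (freezing_oracle \<eta> n T c \<epsilon>)"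
  unfolding stochastic_oracle_def
proof (intro conjI allI impI)
  fix t :: nat assume "t \<ge> 1"
  then obtain k where t: "t = Suc k" by (cases t) auto
  have "subalgebra (past (Suc k)) (past k)"
    unfolding subalgebra_def by (simp add: filtration.sets_F_mono[OF filtration_past])
  then have "gate n T c \<epsilon> (Suc k) \<in> borel_measurable (past (Suc k))"
    using gate_predictable by (rule measurable_from_subalg)
  then show "noise (freezing_oracle \<eta> n T c \<epsilon>) t \<in> borel_measurable (filt (freezing_oracle \<eta> n T c \<epsilon>) t)"
    using measurable_coord_past[of "Suc k" "Suc k"] by (simp add: t)
  show "integrable (law (freezing_oracle \<eta> n T c \<epsilon>)) (noise (freezing_oracle \<eta> n T c \<epsilon>) t)"
    using noise_cond_exp_0(1) by (simp add: t)
  show "AE \<omega> in law (freezing_oracle \<eta> n T c \<epsilon>).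
      real_cond_exp (law (freezing_oracle \<eta> n T c \<epsilon>)) (filt (freezing_oracle \<eta> n T c \<epsilon>) (t - 1))
        (noise (freezing_oracle \<eta> n T c \<epsilon>) t) \<omega> = 0"
    using noise_cond_exp_0(2)[of k n T c \<epsilon>] unfolding freezing_oracle_sel t by simp
qed (auto simp: gauss_seq.prob_space_axioms filtration_past subalgebra_past)

lemma cond_A1_linear: "\<eta> > 0 \<Longrightarrow> cond_A1 (\<lambda>x. x / \<eta>) (1 / \<eta>) 1 0 0"
  by (simp add: cond_A1_def)

lemma cond_A3_freezing:
  assumes "0 \<le> p"
  shows "cond_A3 (freezing_oracle \<eta> n T c \<epsilon>) p (abs_moment p)"
  unfolding cond_A3_def AE_all_countable freezing_oracle_sel
proof
  fix t :: nat
  show "AE \<omega> in gauss_seq. 1 \<le> t \<longrightarrow>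
     real_cond_exp gauss_seq (past (t - 1)) (\<lambda>\<omega>. gate n T c \<epsilon> t \<omega> * \<omega> t) \<omega> = 0 \<and>
     nn_cond_exp gauss_seq (past (t - 1)) (\<lambda>\<omega>. ennreal (\<bar>gate n T c \<epsilon> t \<omega> * \<omega> t\<bar> powr p)) \<omega> \<le> ennreal (abs_moment p)"
  proof (cases t)
    case (Suc k)
    have eq: "ennreal (\<bar>gate n T c \<epsilon> t \<omega> * \<omega> t\<bar> powr p) = ennreal (gate n T c \<epsilon> t \<omega>) * ennreal (\<bar>\<omega> t\<bar> powr p)" for \<omega>
      by (auto simp: gate_def)
    have "AE \<omega> in gauss_seq. nn_cond_exp gauss_seq (past k)
        (\<lambda>\<omega>. ennreal (gate n T c \<epsilon> (Suc k) \<omega>) * ennreal (\<bar>\<omega> (Suc k)\<bar> powr p)) \<omega>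
      = ennreal (gate n T c \<epsilon> (Suc k) \<omega>) * ennreal (abs_moment p)"
      using nn_cond_exp_past[of "\<lambda>\<omega>. ennreal (gate n T c \<epsilon> (Suc k) \<omega>)" k "\<lambda>x. ennreal (\<bar>x\<bar> powr p)"]
        gate_predictable[of n T c \<epsilon> k] assms by (simp add: nn_integral_abs_moment)
    with noise_cond_exp_0(2)[of k n T c \<epsilon>] show ?thesis
      unfolding eq by eventually_elim (auto simp: Suc gate_def)
  qed simp
qed

text \<open>
  The deviation of the accumulated conditional variance from \<open>j\<close> is the number of frozen steps up to \<open>j\<close>.
  It vanishes off the switching event and for \<open>m \<le> n\<close>, and is at most \<open>T - n\<close> otherwise.
\<close>

lemma cond_A4_freezing:
  assumes "n \<le> T" "0 \<le> CS"
    and bound: "\<And>m. 2 \<le> m \<Longrightarrow> n < m \<Longrightarrow>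
      gauss_seq.prob (near_zero n c \<epsilon>) * (real (T - n) / real m) \<le> CS * real m powr (- 3 * \<gamma>)"
  shows "cond_A4 (freezing_oracle \<eta> n T c \<epsilon>) 1 CS \<gamma>"
  unfolding cond_A4_def freezing_oracle_sel
proof (intro conjI allI impI)
  fix m :: nat assume m: "m \<ge> 2"
  define b where "b = (if n < m then real (T - n) / real m else 0)"
  have b0: "0 \<le> b" by (simp add: b_def)
  have "AE \<omega> in gauss_seq. \<forall>k. real_cond_exp gauss_seq (past k) (\<lambda>\<omega>. (gate n T c \<epsilon> (Suc k) \<omega> * \<omega> (Suc k))\<^sup>2) \<omega>
      = gate n T c \<epsilon> (Suc k) \<omega>"
    unfolding AE_all_countable using noise_cond_variance by auto
  then have "AE \<omega> in gauss_seq. (MAX j\<in>{0..m}.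
         \<bar>1 / real m * (\<Sum>t=1..j. real_cond_exp gauss_seq (past (t - 1)) (\<lambda>\<omega>. (gate n T c \<epsilon> t \<omega> * \<omega> t)\<^sup>2) \<omega>)
            - real j / real m * 1\<bar>) \<le> b * indicator (near_zero n c \<epsilon>) \<omega>"
  proof eventually_elim
    fix \<omega> assume *: "\<forall>k. real_cond_exp gauss_seq (past k) (\<lambda>\<omega>. (gate n T c \<epsilon> (Suc k) \<omega> * \<omega> (Suc k))\<^sup>2) \<omega>
      = gate n T c \<epsilon> (Suc k) \<omega>"
    have "\<bar>1 / real m * (\<Sum>t=1..j. real_cond_exp gauss_seq (past (t - 1)) (\<lambda>\<omega>. (gate n T c \<epsilon> t \<omega> * \<omega> t)\<^sup>2) \<omega>)
            - real j / real m * 1\<bar> \<le> b * indicator (near_zero n c \<epsilon>) \<omega>" if j: "j \<in> {0..m}" for j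
    proof -
      have "(\<Sum>t=1..j. real_cond_exp gauss_seq (past (t - 1)) (\<lambda>\<omega>. (gate n T c \<epsilon> t \<omega> * \<omega> t)\<^sup>2) \<omega>)
          = (\<Sum>t=1..j. gate n T c \<epsilon> t \<omega>)"
      proof (intro sum.cong refl)
        fix t assume "t \<in> {1..j}"
        then show "real_cond_exp gauss_seq (past (t - 1)) (\<lambda>\<omega>. (gate n T c \<epsilon> t \<omega> * \<omega> t)\<^sup>2) \<omega> = gate n T c \<epsilon> t \<omega>"
          using *[rule_format, of "t - 1"] by simp
      qed
      also have "\<dots> = real j - (\<Sum>t=1..j. 1 - gate n T c \<epsilon> t \<omega>)" by (simp add: sum_subtractf)
      finally have "\<bar>1 / real m * (\<Sum>t=1..j. real_cond_exp gauss_seq (past (t - 1)) (\<lambda>\<omega>. (gate n T c \<epsilon> t \<omega> * \<omega> t)\<^sup>2) \<omega>)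
            - real j / real m * 1\<bar> = \<bar>(\<Sum>t=1..j. 1 - gate n T c \<epsilon> t \<omega>) / real m\<bar>"
        by (simp add: diff_divide_distrib)
      also have "(\<Sum>t=1..j. 1 - gate n T c \<epsilon> t \<omega>) = real (card ({1..j} \<inter> {n<..T})) * indicator (near_zero n c \<epsilon>) \<omega>"
      proof -
        have "(\<Sum>t=1..j. 1 - gate n T c \<epsilon> t \<omega>)
          = (\<Sum>t=1..j. indicator {n<..T} t * indicator (near_zero n c \<epsilon>) \<omega>)"
          by (intro sum.cong) (auto simp: gate_def indicator_def)
        also have "\<dots> = (\<Sum>t=1..j. indicator {n<..T} t) * indicator (near_zero n c \<epsilon>) \<omega>"
          by (rule sum_distrib_right[symmetric])
        also have "(\<Sum>t=1..j. indicator {n<..T} t :: real) = real (card ({1..j} \<inter> {n<..T}))"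
          by (simp add: indicator_def sum.If_cases Int_def)
        finally show ?thesis .
      qed
      also have "\<bar>real (card ({1..j} \<inter> {n<..T})) * indicator (near_zero n c \<epsilon>) \<omega> / real m\<bar>
          \<le> b * indicator (near_zero n c \<epsilon>) \<omega>"
      proof -
        have "card ({1..j} \<inter> {n<..T}) \<le> card {n<..T}" by (intro card_mono) auto
        moreover have "card ({1..j} \<inter> {n<..T}) = 0" if "\<not> n < m" using that j by auto
        ultimately have "real (card ({1..j} \<inter> {n<..T})) / real m \<le> b"
          by (auto simp: b_def intro!: divide_right_mono)
        then show ?thesis by (auto simp: indicator_def)
      qed
      finally show ?thesis .
    qed
    then show "(MAX j\<in>{0..m}.
         \<bar>1 / real m * (\<Sum>t=1..j. real_cond_exp gauss_seq (past (t - 1)) (\<lambda>\<omega>. (gate n T c \<epsilon> t \<omega> * \<omega> t)\<^sup>2) \<omega>)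
            - real j / real m * 1\<bar>) \<le> b * indicator (near_zero n c \<epsilon>) \<omega>"
      by (intro Max.boundedI) auto
  qed
  then have "(\<integral>\<^sup>+ \<omega>. ennreal (MAX j\<in>{0..m}.
         \<bar>1 / real m * (\<Sum>t=1..j. real_cond_exp gauss_seq (past (t - 1)) (\<lambda>\<omega>. (gate n T c \<epsilon> t \<omega> * \<omega> t)\<^sup>2) \<omega>)
            - real j / real m * 1\<bar>) \<partial>gauss_seq)
      \<le> (\<integral>\<^sup>+ \<omega>. ennreal b * indicator (near_zero n c \<epsilon>) \<omega> \<partial>gauss_seq)"
    by (intro nn_integral_mono_AE, elim eventually_mono)
       (auto simp: indicator_def intro!: ennreal_leI split: if_splits)
  also have "\<dots> = ennreal (gauss_seq.prob (near_zero n c \<epsilon>) * b)"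
    by (simp add: nn_integral_cmult_indicator gauss_seq.emeasure_eq_measure b0 ennreal_mult[symmetric] mult.commute)
  also have "\<dots> \<le> ennreal (CS * real m powr (- 3 * \<gamma>))"
    using bound[OF m] assms(2) by (intro ennreal_leI) (auto simp: b_def)
  finally show "(\<integral>\<^sup>+ \<omega>. ennreal (MAX j\<in>{0..m}.
         \<bar>1 / real m * (\<Sum>t=1..j. real_cond_exp gauss_seq (past (t - 1)) (\<lambda>\<omega>. (gate n T c \<epsilon> t \<omega> * \<omega> t)\<^sup>2) \<omega>)
            - real j / real m * 1\<bar>) \<partial>gauss_seq) \<le> ennreal (CS * real m powr (- 3 * \<gamma>))" .
qed simp

text \<open>
  On each of the two events, switch on or off, the iterate coincides with a Gaussian linear combination:
  all the noise, or the noise outside the frozen window. Bounding the moment by the sum of the two Gaussian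
  moments removes the dependence between the switch and the noise.
\<close>

lemma cond_A5_freezing:
  assumes "\<eta> > 0" "0 < \<alpha>" "\<alpha> < 1" "0 < q"
  shows "cond_A5 (freezing_oracle \<eta> n T c \<epsilon>) (step_size \<eta> \<alpha>) q
    (2 * \<eta> powr q * abs_moment (2 * q) / (1 - \<alpha>) powr q)"
  unfolding cond_A5_def freezing_oracle_sel
proof (intro allI impI)
  fix t :: nat assume "t \<ge> 1"
  then obtain k where t: "t = Suc k" by (cases t) auto
  let ?M = "freezing_oracle \<eta> n T c \<epsilon>"
  define u where "u = step_size 1 \<alpha> t / (1 - \<alpha>)"
  define I where "I = {1..k} - {n<..T}"
  define S where "S J \<omega> = (\<Sum>s\<in>J. response \<alpha> s k * \<omega> s)" for J \<omega>
  have u: "0 \<le> u" using step_size_1_bounds[of t \<alpha>] assms t by (simp add: u_def)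
  have bound: "\<bar>iterate (step_size \<eta> \<alpha>) ?M t \<omega>\<bar> powr (2 * q)
      \<le> \<eta> powr (2 * q) * (\<bar>S I \<omega>\<bar> powr (2 * q) + \<bar>S {1..k} \<omega>\<bar> powr (2 * q))" for \<omega>
  proof -
    have "(\<Sum>s=1..k. response \<alpha> s k * (gate n T c \<epsilon> s \<omega> * \<omega> s)) \<in> {S I \<omega>, S {1..k} \<omega>}"
    proof (cases "\<omega> \<in> near_zero n c \<epsilon>")
      case True
      then have "(\<Sum>s=1..k. response \<alpha> s k * (gate n T c \<epsilon> s \<omega> * \<omega> s)) = S I \<omega>"
        unfolding S_def I_def by (intro sum.mono_neutral_cong_right) (auto simp: gate_def)
      then show ?thesis by simp
    next
      case False
      then show ?thesis by (simp add: S_def gate_def)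
    qed
    then have "\<bar>\<Sum>s=1..k. response \<alpha> s k * (gate n T c \<epsilon> s \<omega> * \<omega> s)\<bar> powr (2 * q)
        \<le> \<bar>S I \<omega>\<bar> powr (2 * q) + \<bar>S {1..k} \<omega>\<bar> powr (2 * q)" by auto
    then show ?thesis
      using iterate_eq_sum_response[of \<eta> ?M \<alpha> k \<omega>] assms
      by (simp add: t abs_mult powr_mult)
  qed
  have var: "(\<Sum>s\<in>J. (response \<alpha> s k)\<^sup>2) powr (2 * q / 2) \<le> u powr q" if "J \<subseteq> {1..k}" for J
  proof -
    have "(\<Sum>s\<in>J. (response \<alpha> s k)\<^sup>2) \<le> (\<Sum>s=1..k. (response \<alpha> s k)\<^sup>2)"
      using that by (intro sum_mono2) auto
    also have "\<dots> \<le> u" using sum_response_sq_le[of \<alpha> k] assms by (simp add: u_def t)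
    finally show ?thesis using assms by (simp add: powr_mono2 sum_nonneg)
  qed
  have mom: "(\<integral>\<^sup>+\<omega>. ennreal (\<bar>S J \<omega>\<bar> powr (2 * q)) \<partial>gauss_seq) \<le> ennreal (u powr q * abs_moment (2 * q))"
    if "J \<subseteq> {1..k}" for J
    unfolding S_def using that assms var[OF that] finite_subset[OF that]
    by (subst moment_lincomb) (auto intro!: ennreal_leI mult_right_mono abs_moment_nonneg)
  have [measurable]: "S J \<in> borel_measurable gauss_seq" for J
    unfolding S_def[abs_def] by measurable
  have "(\<integral>\<^sup>+ \<omega>. ennreal (\<bar>iterate (step_size \<eta> \<alpha>) ?M t \<omega>\<bar> powr (2 * q)) \<partial>gauss_seq)
      \<le> (\<integral>\<^sup>+ \<omega>. ennreal (\<eta> powr (2 * q)) * (ennreal (\<bar>S I \<omega>\<bar> powr (2 * q)) + ennreal (\<bar>S {1..k} \<omega>\<bar> powr (2 * q))) \<partial>gauss_seq)"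
    using bound by (intro nn_integral_mono) (simp add: ennreal_mult[symmetric] ennreal_plus[symmetric] del: ennreal_plus)
  also have "\<dots> = ennreal (\<eta> powr (2 * q)) * ((\<integral>\<^sup>+ \<omega>. ennreal (\<bar>S I \<omega>\<bar> powr (2 * q)) \<partial>gauss_seq)
      + (\<integral>\<^sup>+ \<omega>. ennreal (\<bar>S {1..k} \<omega>\<bar> powr (2 * q)) \<partial>gauss_seq))"
    by (simp add: nn_integral_cmult nn_integral_add)
  also have "\<dots> \<le> ennreal (\<eta> powr (2 * q)) * (ennreal (u powr q * abs_moment (2 * q)) + ennreal (u powr q * abs_moment (2 * q)))"
    by (intro mult_left_mono add_mono mom) (auto simp: I_def)
  also have "\<dots> = ennreal (\<eta> powr (2 * q) * (2 * (u powr q * abs_moment (2 * q))))"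
    by (simp add: ennreal_mult[symmetric] ennreal_plus[symmetric] abs_moment_nonneg del: ennreal_plus)
  also have "\<eta> powr (2 * q) * (2 * (u powr q * abs_moment (2 * q)))
      = 2 * \<eta> powr q * abs_moment (2 * q) / (1 - \<alpha>) powr q * step_size \<eta> \<alpha> t powr q"
  proof -
    have "step_size \<eta> \<alpha> t powr q = \<eta> powr q * step_size 1 \<alpha> t powr q"
      using assms by (simp add: step_size_def powr_mult)
    moreover have "u powr q = step_size 1 \<alpha> t powr q / (1 - \<alpha>) powr q"
      using assms by (simp add: u_def powr_divide step_size_def)
    moreover have "\<eta> powr (2 * q) = \<eta> powr q * \<eta> powr q"
      by (simp add: powr_add[symmetric])
    ultimately show ?thesis by simp
  qed
  finally show "(\<integral>\<^sup>+ \<omega>. ennreal (\<bar>iterate (step_size \<eta> \<alpha>) ?M t \<omega>\<bar> powr (2 * q)) \<partial>gauss_seq)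
      \<le> ennreal (2 * \<eta> powr q * abs_moment (2 * q) / (1 - \<alpha>) powr q * step_size \<eta> \<alpha> t powr q)" .
qed

section \<open>The law of the endpoint\<close>

definition final_value :: "nat \<Rightarrow> nat \<Rightarrow> (nat \<Rightarrow> real) \<Rightarrow> real \<Rightarrow> (nat \<Rightarrow> real) \<Rightarrow> real" where
  "final_value n T c \<epsilon> \<omega> = (\<Sum>s=1..T. c s * (gate n T c \<epsilon> s \<omega> * \<omega> s))"

lemma final_value_eq:
  assumes "n \<le> T"
  shows "final_value n T c \<epsilon> \<omega> = (\<Sum>s=1..n. c s * \<omega> s)
    + (if \<omega> \<in> near_zero n c \<epsilon> then 0 else \<Sum>s\<in>{n<..T}. c s * \<omega> s)"
proof -
  have "{1..T} = {1..n} \<union> {n<..T}" using assms by auto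
  then have "final_value n T c \<epsilon> \<omega> = (\<Sum>s=1..n. c s * (gate n T c \<epsilon> s \<omega> * \<omega> s))
      + (\<Sum>s\<in>{n<..T}. c s * (gate n T c \<epsilon> s \<omega> * \<omega> s))"
    unfolding final_value_def by (simp only:) (rule sum.union_disjoint, auto)
  also have "(\<Sum>s=1..n. c s * (gate n T c \<epsilon> s \<omega> * \<omega> s)) = (\<Sum>s=1..n. c s * \<omega> s)"
    by (intro sum.cong) (auto simp: gate_def)
  also have "(\<Sum>s\<in>{n<..T}. c s * (gate n T c \<epsilon> s \<omega> * \<omega> s))
      = (if \<omega> \<in> near_zero n c \<epsilon> then 0 else \<Sum>s\<in>{n<..T}. c s * \<omega> s)"
    by (auto simp: gate_def intro!: sum.neutral sum.cong)
  finally show ?thesis .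
qed

lemma gate_measurable [measurable]: "gate n T c \<epsilon> t \<in> borel_measurable gauss_seq"
  unfolding gate_def[abs_def] by measurable

lemma final_value_measurable [measurable]: "final_value n T c \<epsilon> \<in> borel_measurable gauss_seq"
  unfolding final_value_def[abs_def] by measurable

lemma indep_front_tail:
  "gauss_seq.indep_var borel (\<lambda>\<omega>. \<Sum>s=1..n. c s * \<omega> s) borel (\<lambda>\<omega>. \<Sum>s\<in>{n<..T}. c s * \<omega> s)"
proof -
  have lin: "(\<lambda>x. \<Sum>s\<in>I. c s * x s) \<in> borel_measurable (PiM I (\<lambda>_. borel))" for I
    by (intro borel_measurable_sum borel_measurable_times) auto
  have "gauss_seq.indep_var (PiM {1..n} (\<lambda>_. borel)) (\<lambda>\<omega>. restrict (\<lambda>i. \<omega> i) {1..n})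
      (PiM {n<..T} (\<lambda>_. borel)) (\<lambda>\<omega>. restrict (\<lambda>i. \<omega> i) {n<..T})"
    by (rule gauss_seq.indep_var_restrict[OF indep_coords]) auto
  from gauss_seq.indep_var_compose[OF this lin lin] show ?thesis by (simp add: comp_def)
qed

text \<open>
  The final value is \<open>Y\<close> if \<open>\<bar>Y\<bar> < \<epsilon>\<close> and \<open>Y + Z\<close> otherwise. The first case contributes the mass of
  \<open>(- \<epsilon>, \<epsilon>)\<close> under \<open>Y\<close>. From the second it is enough to keep the paths with \<open>Y\<close> in \<open>(\<epsilon>, 2 \<epsilon>)\<close> that
  an independent \<open>Z\<close> in \<open>(- 2 \<epsilon>, - \<epsilon>)\<close> carries back into the interval. As \<open>\<epsilon>\<close> is the standard deviation
  of \<open>Z\<close>, the latter event has a probability bounded below by a constant. The exponential factor compares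
  the density of \<open>Y\<close> on \<open>(- 2 \<epsilon>, 2 \<epsilon>)\<close> with its maximum.
\<close>

lemma prob_final_value_near_zero_ge:
  fixes c :: "nat \<Rightarrow> real"
  assumes "n < T" "1 \<le> n" "\<And>s. s \<in> {1..T} \<Longrightarrow> c s \<noteq> 0"
  defines "\<sigma> \<equiv> sqrt (\<Sum>s=1..n. (c s)\<^sup>2)" and "\<epsilon> \<equiv> sqrt (\<Sum>s\<in>{n<..T}. (c s)\<^sup>2)"
  shows "\<epsilon> / (\<sigma> * sqrt (2 * pi)) * exp (- 2 * \<epsilon>\<^sup>2 / \<sigma>\<^sup>2) * (2 + exp (- 2) / sqrt (2 * pi))
    \<le> gauss_seq.prob {\<omega>. \<bar>final_value n T c \<epsilon> \<omega>\<bar> < \<epsilon>}"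
proof -
  define Y where "Y \<omega> = (\<Sum>s=1..n. c s * \<omega> s)" for \<omega> :: "nat \<Rightarrow> real"
  define Z where "Z \<omega> = (\<Sum>s\<in>{n<..T}. c s * \<omega> s)" for \<omega> :: "nat \<Rightarrow> real"
  have \<sigma>: "0 < \<sigma>" unfolding \<sigma>_def using assms by (auto intro!: sum_pos2[of _ 1])
  have \<epsilon>: "0 < \<epsilon>" unfolding \<epsilon>_def using assms by (auto intro!: sum_pos2[of _ T])
  have [measurable]: "Y \<in> borel_measurable gauss_seq" "Z \<in> borel_measurable gauss_seq"
    unfolding Y_def[abs_def] Z_def[abs_def] by measurable
  have dY: "distributed gauss_seq lborel Y (normal_density 0 \<sigma>)"
    unfolding Y_def[abs_def] \<sigma>_def using assms by (intro distributed_lincomb[where i = 1]) auto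
  have dZ: "distributed gauss_seq lborel Z (normal_density 0 \<epsilon>)"
    unfolding Z_def[abs_def] \<epsilon>_def using assms by (intro distributed_lincomb[where i = T]) auto
  have fv: "final_value n T c \<epsilon> \<omega> = (if \<bar>Y \<omega>\<bar> < \<epsilon> then Y \<omega> else Y \<omega> + Z \<omega>)" for \<omega>
    using final_value_eq[of n T c \<epsilon> \<omega>] assms by (simp add: Y_def Z_def near_zero_def)
  define E where "E = exp (- 2 * \<epsilon>\<^sup>2 / \<sigma>\<^sup>2)"
  define A where "A = Y -` {-\<epsilon><..<\<epsilon>} \<inter> space gauss_seq"
  define B where "B = (Y -` {\<epsilon><..<2*\<epsilon>} \<inter> space gauss_seq) \<inter> (Z -` {-2*\<epsilon><..<-\<epsilon>} \<inter> space gauss_seq)"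
  have AB [measurable]: "A \<in> sets gauss_seq" "B \<in> sets gauss_seq" unfolding A_def B_def by measurable
  have "(\<epsilon> - - \<epsilon>) / (\<sigma> * sqrt (2 * pi)) * exp (- \<epsilon>\<^sup>2 / (2 * \<sigma>\<^sup>2)) \<le> gauss_seq.prob A"
    unfolding A_def using \<epsilon> by (intro gauss_seq.normal_prob_ge[OF dY \<sigma>]) auto
  then have "2 * \<epsilon> / (\<sigma> * sqrt (2 * pi)) * exp (- \<epsilon>\<^sup>2 / (2 * \<sigma>\<^sup>2)) \<le> gauss_seq.prob A"
    by simp
  moreover have "2 * \<epsilon> / (\<sigma> * sqrt (2 * pi)) * E \<le> 2 * \<epsilon> / (\<sigma> * sqrt (2 * pi)) * exp (- \<epsilon>\<^sup>2 / (2 * \<sigma>\<^sup>2))"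
    using \<sigma> \<epsilon> by (intro mult_left_mono) (auto simp: E_def field_simps)
  ultimately have pA: "2 * \<epsilon> / (\<sigma> * sqrt (2 * pi)) * E \<le> gauss_seq.prob A" by linarith
  have pB: "\<epsilon> / (\<sigma> * sqrt (2 * pi)) * E * (exp (- 2) / sqrt (2 * pi)) \<le> gauss_seq.prob B"
  proof -
    have "gauss_seq.prob B = gauss_seq.prob (Y -` {\<epsilon><..<2*\<epsilon>} \<inter> space gauss_seq)
        * gauss_seq.prob (Z -` {-2*\<epsilon><..<-\<epsilon>} \<inter> space gauss_seq)"
    proof -
      have "B = (\<lambda>x. (Y x, Z x)) -` ({\<epsilon><..<2*\<epsilon>} \<times> {-2*\<epsilon><..<-\<epsilon>}) \<inter> space gauss_seq"
        by (auto simp: B_def)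
      then show ?thesis
        using gauss_seq.indep_varD[OF indep_front_tail[of c n T], of "{\<epsilon><..<2*\<epsilon>}" "{-2*\<epsilon><..<-\<epsilon>}"]
        by (simp add: Y_def[abs_def] Z_def[abs_def])
    qed
    moreover have "(2 * \<epsilon> - \<epsilon>) / (\<sigma> * sqrt (2 * pi)) * exp (- (2 * \<epsilon>)\<^sup>2 / (2 * \<sigma>\<^sup>2))
        \<le> gauss_seq.prob (Y -` {\<epsilon><..<2*\<epsilon>} \<inter> space gauss_seq)"
      using \<epsilon> by (intro gauss_seq.normal_prob_ge[OF dY \<sigma>]) auto
    then have "\<epsilon> / (\<sigma> * sqrt (2 * pi)) * E \<le> gauss_seq.prob (Y -` {\<epsilon><..<2*\<epsilon>} \<inter> space gauss_seq)"
      by (simp add: E_def power_mult_distrib)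
    moreover have "(- \<epsilon> - - 2 * \<epsilon>) / (\<epsilon> * sqrt (2 * pi)) * exp (- (2 * \<epsilon>)\<^sup>2 / (2 * \<epsilon>\<^sup>2))
        \<le> gauss_seq.prob (Z -` {-2*\<epsilon><..<-\<epsilon>} \<inter> space gauss_seq)"
      using \<epsilon> by (intro gauss_seq.normal_prob_ge[OF dZ \<epsilon>]) auto
    then have "exp (- 2) / sqrt (2 * pi) \<le> gauss_seq.prob (Z -` {-2*\<epsilon><..<-\<epsilon>} \<inter> space gauss_seq)"
      using \<epsilon> by (simp add: power_mult_distrib)
    ultimately show ?thesis
      using \<sigma> \<epsilon> by (simp only:) (intro mult_mono, auto simp: E_def)
  qed
  have "gauss_seq.prob A + gauss_seq.prob B = gauss_seq.prob (A \<union> B)"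
    by (rule gauss_seq.finite_measure_Union[OF AB, symmetric]) (auto simp: A_def B_def)
  also have "\<dots> \<le> gauss_seq.prob {\<omega>. \<bar>final_value n T c \<epsilon> \<omega>\<bar> < \<epsilon>}"
  proof (rule gauss_seq.finite_measure_mono)
    show "A \<union> B \<subseteq> {\<omega>. \<bar>final_value n T c \<epsilon> \<omega>\<bar> < \<epsilon>}"
      using \<epsilon> by (auto simp: A_def B_def fv)
    have "{\<omega> \<in> space gauss_seq. \<bar>final_value n T c \<epsilon> \<omega>\<bar> < \<epsilon>} \<in> sets gauss_seq"
      using assms by measurable
    then show "{\<omega>. \<bar>final_value n T c \<epsilon> \<omega>\<bar> < \<epsilon>} \<in> sets gauss_seq" by simp
  qed
  finally have *: "gauss_seq.prob A + gauss_seq.prob B \<le> gauss_seq.prob {\<omega>. \<bar>final_value n T c \<epsilon> \<omega>\<bar> < \<epsilon>}" .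
  define K where "K = \<epsilon> / (\<sigma> * sqrt (2 * pi))"
  define r where "r = exp (- 2) / sqrt (2 * pi)"
  have "K * E * (2 + r) = 2 * K * E + K * E * r" by algebra
  also have "\<dots> \<le> gauss_seq.prob A + gauss_seq.prob B"
    using pA pB unfolding K_def r_def by (intro add_mono) simp_all
  finally show ?thesis using * unfolding K_def r_def E_def by linarith
qed

lemma freezing_path_at_1:
  assumes "\<eta> > 0" "T \<ge> 1"
  shows "sa_path (step_size \<eta> \<alpha>) T (freezing_oracle \<eta> n T c \<epsilon>) \<omega> 1
    = \<eta> * (\<Sum>s=1..T. weight \<alpha> T s / sqrt (real T) * (gate n T c \<epsilon> s \<omega> * \<omega> s))"
proof -
  let ?M = "freezing_oracle \<eta> n T c \<epsilon>"
  have "sa_path (step_size \<eta> \<alpha>) T ?M \<omega> 1 = (\<Sum>t=1..T. iterate (step_size \<eta> \<alpha>) ?M (t + 1) \<omega>) / sqrt (real T)"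
    by (simp add: sa_path_def Let_def del: iterate.simps)
  also have "\<dots> = \<eta> * ((\<Sum>s=1..T. weight \<alpha> T s * noise ?M s \<omega>) / sqrt (real T))"
    using sum_iterate_eq_sum_weight[where M = ?M and \<eta> = \<eta> and \<alpha> = \<alpha> and T = T and \<omega> = \<omega>] assms by simp
  finally show ?thesis by (simp add: sum_divide_distrib)
qed

lemma iterate_freezing_measurable:
  assumes "\<eta> > 0"
  shows "iterate (step_size \<eta> \<alpha>) (freezing_oracle \<eta> n T c \<epsilon>) (t + 1) \<in> borel_measurable gauss_seq"
proof -
  have "iterate (step_size \<eta> \<alpha>) (freezing_oracle \<eta> n T c \<epsilon>) (t + 1)
      = (\<lambda>\<omega>. \<eta> * (\<Sum>s=1..t. response \<alpha> s t * (gate n T c \<epsilon> s \<omega> * \<omega> s)))"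
    using iterate_eq_sum_response[of \<eta> "freezing_oracle \<eta> n T c \<epsilon>" \<alpha> t] assms by (simp add: fun_eq_iff)
  also have "\<dots> \<in> borel_measurable gauss_seq" by measurable
  finally show ?thesis .
qed

lemma prob_path_endpoint:
  fixes \<alpha> \<eta> \<epsilon> :: real and n T :: nat
  assumes "\<eta> > 0" "T \<ge> 1"
  defines "c \<equiv> (\<lambda>s. weight \<alpha> T s / sqrt (real T))"
  shows "measure (distr gauss_seq skorokhod_borel (sa_path (step_size \<eta> \<alpha>) T (freezing_oracle \<eta> n T c \<epsilon>)))
      {f \<in> cadlag_space. \<bar>f 1\<bar> < \<eta> * \<epsilon>} = gauss_seq.prob {\<omega>. \<bar>final_value n T c \<epsilon> \<omega>\<bar> < \<epsilon>}"
proof -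
  let ?M = "freezing_oracle \<eta> n T c \<epsilon>"
  have "(\<lambda>\<omega>. polygonal_path T (\<lambda>t. iterate (step_size \<eta> \<alpha>) ?M (t + 1) \<omega>)) \<in> measurable gauss_seq skorokhod_borel"
    using assms by (intro polygonal_path_measurable iterate_freezing_measurable) auto
  then have meas: "sa_path (step_size \<eta> \<alpha>) T ?M \<in> measurable gauss_seq skorokhod_borel"
    by (simp only: sa_path_eq_polygonal[symmetric])
  have "sa_path (step_size \<eta> \<alpha>) T ?M -` {f \<in> cadlag_space. \<bar>f 1\<bar> < \<eta> * \<epsilon>} \<inter> space gauss_seq
      = {\<omega>. \<bar>final_value n T c \<epsilon> \<omega>\<bar> < \<epsilon>}"
  proof -
    have "sa_path (step_size \<eta> \<alpha>) T ?M \<omega> \<in> cadlag_space" for \<omega>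
      by (simp add: sa_path_eq_polygonal polygonal_path_cadlag)
    moreover have "sa_path (step_size \<eta> \<alpha>) T ?M \<omega> 1 = \<eta> * final_value n T c \<epsilon> \<omega>" for \<omega>
      using freezing_path_at_1[OF assms(1,2), of \<alpha> n c \<epsilon> \<omega>] by (simp add: final_value_def c_def)
    ultimately show ?thesis using assms(1) by (auto simp: abs_mult)
  qed
  then show ?thesis by (subst measure_distr[OF meas endpoint_ball_in_borel]) simp
qed

text \<open>
  By the Lipschitz property, the \<open>\<delta>\<close>-neighbourhood of the paths with \<open>\<bar>f 1\<bar> < \<eta> \<epsilon>\<close> consists of paths with
  \<open>\<bar>f 1\<bar> < \<eta> \<epsilon> + \<delta>\<close>; the limit path ends in \<open>\<eta> W(1)\<close>.
\<close>

lemma target_endpoint_le: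
  assumes BM: "standard_brownian_motion N W" and "\<eta> > 0" "\<epsilon> > 0" "\<delta> > 0"
  shows "measure (distr N skorokhod_borel (target_path W (1 / \<eta>) 1))
      (skorokhod_nbhd {f \<in> cadlag_space. \<bar>f 1\<bar> < \<eta> * \<epsilon>} \<delta>) \<le> 2 * (\<epsilon> + \<delta> / \<eta>) / sqrt (2 * pi)"
proof -
  interpret N: prob_space N using BM by (simp add: standard_brownian_motion_def)
  define X where "X \<omega> = W 1 \<omega> - W 0 \<omega>" for \<omega>
  define a where "a = \<epsilon> + \<delta> / \<eta>"
  have a: "0 < a" using assms by (simp add: a_def add_pos_pos)
  have X: "distributed N lborel X (normal_density 0 1)"
  proof -
    have "\<forall>s t. 0 \<le> s \<and> s < t \<and> t \<le> 1 \<longrightarrow>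
        distributed N lborel (\<lambda>\<omega>. W t \<omega> - W s \<omega>) (normal_density 0 (sqrt (t - s)))"
      using BM unfolding standard_brownian_motion_def by (elim conjE)
    from this[rule_format, of 0 1] show ?thesis by (simp add: X_def[abs_def])
  qed
  have W0: "W 0 \<omega> = 0" if "\<omega> \<in> space N" for \<omega> using BM that by (simp add: standard_brownian_motion_def)
  have "measure (distr N skorokhod_borel (target_path W (1 / \<eta>) 1))
      (skorokhod_nbhd {f \<in> cadlag_space. \<bar>f 1\<bar> < \<eta> * \<epsilon>} \<delta>) \<le> N.prob (X -` {-a..a} \<inter> space N)"
  proof (rule measure_distr_le)
    show "target_path W (1 / \<eta>) 1 -` skorokhod_nbhd {f \<in> cadlag_space. \<bar>f 1\<bar> < \<eta> * \<epsilon>} \<delta> \<inter> space N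
        \<subseteq> X -` {-a..a} \<inter> space N"
    proof
      fix \<omega> assume \<omega>: "\<omega> \<in> target_path W (1 / \<eta>) 1 -` skorokhod_nbhd {f \<in> cadlag_space. \<bar>f 1\<bar> < \<eta> * \<epsilon>} \<delta> \<inter> space N"
      then have "\<bar>target_path W (1 / \<eta>) 1 \<omega> 1\<bar> < \<eta> * \<epsilon> + \<delta>"
        using nbhd_endpoint_ball_subset[of "\<eta> * \<epsilon>" \<delta>] by auto
      then have "\<eta> * \<bar>X \<omega>\<bar> < \<eta> * a"
        using \<omega> W0[of \<omega>] assms by (simp add: target_path_def X_def a_def abs_mult distrib_left)
      then show "\<omega> \<in> X -` {-a..a} \<inter> space N" using \<omega> assms by auto
    qed
    show "X -` {-a..a} \<inter> space N \<in> sets N"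
      using distributed_measurable[OF X] by (rule measurable_sets) auto
  qed (rule N.finite_measure_axioms)
  also have "\<dots> \<le> (a - - a) / (1 * sqrt (2 * pi))"
    using a by (intro N.normal_prob_le[OF X]) auto
  finally show ?thesis by (simp add: a_def)
qed

section \<open>Choice of the freezing window\<close>

text \<open>
  A window of \<open>T powr (1 - 2 \<gamma>)\<close> steps contributes a standard deviation of order \<open>T powr (- \<gamma>)\<close> to the
  endpoint of the path.
\<close>

definition freeze_start :: "real \<Rightarrow> nat \<Rightarrow> nat" where
  "freeze_start \<gamma> T = T - nat \<lceil>real T powr (1 - 2 * \<gamma>)\<rceil>"

definition path_weight :: "real \<Rightarrow> nat \<Rightarrow> nat \<Rightarrow> real" where
  "path_weight \<alpha> T s = weight \<alpha> T s / sqrt (real T)"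

definition front_sd :: "real \<Rightarrow> real \<Rightarrow> nat \<Rightarrow> real" where
  "front_sd \<alpha> \<gamma> T = sqrt (\<Sum>s=1..freeze_start \<gamma> T. (path_weight \<alpha> T s)\<^sup>2)"

definition tail_sd :: "real \<Rightarrow> real \<Rightarrow> nat \<Rightarrow> real" where
  "tail_sd \<alpha> \<gamma> T = sqrt (\<Sum>s\<in>{freeze_start \<gamma> T<..T}. (path_weight \<alpha> T s)\<^sup>2)"

lemma eventually_powr_neg_le:
  fixes \<beta> \<delta> :: real
  assumes "\<beta> > 0" "\<delta> > 0"
  shows "\<forall>\<^sub>F T in sequentially. real T powr (- \<beta>) \<le> \<delta>"
proof -
  have "((\<lambda>T. real T powr (- \<beta>)) \<longlongrightarrow> 0) sequentially"
    using assms by (intro tendsto_neg_powr filterlim_real_sequentially) auto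
  from order_tendstoD(2)[OF this \<open>0 < \<delta>\<close>] show ?thesis by eventually_elim simp
qed

text \<open>
  The three smallness conditions say, for a window of length \<open>P = T powr (1 - 2 \<gamma>)\<close>, that
  \<open>T powr \<alpha> \<le> P / 4\<close>, \<open>4 \<le> P\<close> and \<open>P \<le> T / 4\<close>: the window is at least four times as long as the
  relaxation time and takes up at most about a quarter of the horizon. The lower bounds on the standard
  deviations count the indices with weight at least one half, which include those at distance at least \<open>T powr \<alpha>\<close> from the end.
\<close>

lemma sd_bounds:
  fixes \<alpha> \<gamma> :: real and T :: nat
  assumes \<alpha>: "0 < \<alpha>" "\<alpha> < 1" and \<gamma>: "0 < \<gamma>" "\<gamma> < 1 / 2" and "4 \<le> T"
    and d1: "real T powr (\<alpha> - (1 - 2 * \<gamma>)) \<le> 1 / 4"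
    and d2: "real T powr (- (1 - 2 * \<gamma>)) \<le> 1 / 4"
    and d3: "real T powr (- (2 * \<gamma>)) \<le> 1 / 4"
  defines "n \<equiv> freeze_start \<gamma> T"
  shows "1 \<le> n" "n < T" "real T \<le> 2 * real n" "real (T - n) \<le> 2 * real T powr (1 - 2 * \<gamma>)"
    and "1 / 4 \<le> front_sd \<alpha> \<gamma> T"
    and "(front_sd \<alpha> \<gamma> T)\<^sup>2 \<le> 1 + 2 / (1 - \<alpha>)\<^sup>2 * real T powr (\<alpha> - 1)"
    and "real T powr (- \<gamma>) / 3 \<le> tail_sd \<alpha> \<gamma> T"
    and "tail_sd \<alpha> \<gamma> T \<le> 2 / (1 - \<alpha>) * real T powr (- \<gamma>)"
    and "\<And>s. s \<in> {1..T} \<Longrightarrow> path_weight \<alpha> T s \<noteq> 0"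
proof -
  define P where "P = real T powr (1 - 2 * \<gamma>)"
  define A where "A = real T powr \<alpha>"
  have T: "real T > 0" using \<open>4 \<le> T\<close> by simp
  have P: "P > 0" "A > 0" using T by (auto simp: P_def A_def)
  have "real T powr (\<alpha> - (1 - 2 * \<gamma>)) = A / P" by (simp only: powr_diff A_def P_def)
  then have "A / P \<le> 1 / 4" using d1 by simp
  then have AP: "A \<le> P / 4" using P by (simp add: field_simps)
  have "real T powr (- (1 - 2 * \<gamma>)) = 1 / P" by (simp only: powr_minus_divide P_def)
  then have "1 / P \<le> 1 / 4" using d2 by simp
  then have P4: "4 \<le> P" using P by (simp add: field_simps)
  have PT: "P \<le> real T / 4"
    using d3 T by (simp add: P_def powr_diff powr_minus_divide field_simps)
  define k where "k = nat \<lceil>P\<rceil>"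
  have k: "P \<le> real k" "real k \<le> P + 1" using P by (auto simp: k_def)
  have kT: "k < T" using k PT \<open>4 \<le> T\<close> by linarith
  have n: "n = T - k" by (simp add: n_def freeze_start_def k_def P_def)
  show n1: "1 \<le> n" "n < T" using n kT k P4 by auto
  show nT: "real T \<le> 2 * real n" using n kT k PT \<open>4 \<le> T\<close> by (simp add: of_nat_diff)
  have Tn: "T - n = k" using n kT by simp
  show "real (T - n) \<le> 2 * real T powr (1 - 2 * \<gamma>)" using Tn k P4 by (simp add: P_def)
  have half: "1 / 2 \<le> weight \<alpha> T s" if s: "1 \<le> s" "s \<le> T" "A \<le> real (Suc T - s)" for s
  proof -
    have "real s powr \<alpha> \<le> A" unfolding A_def using s \<alpha> by (intro powr_mono2) auto
    then show ?thesis using s \<alpha> by (intro weight_ge_half) auto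
  qed
  have sq: "(path_weight \<alpha> T s)\<^sup>2 = (weight \<alpha> T s)\<^sup>2 / real T" for s
    using T by (simp add: path_weight_def power_divide)
  have lower: "1 / (4 * real T) \<le> (path_weight \<alpha> T s)\<^sup>2" if s: "1 \<le> s" "s \<le> T" "A \<le> real (Suc T - s)" for s
  proof -
    have "(1 / 2)\<^sup>2 \<le> (weight \<alpha> T s)\<^sup>2" using half[OF s] by (intro power_mono) auto
    then show ?thesis unfolding sq using T by (simp add: power2_eq_square field_simps)
  qed
  show "1 / 4 \<le> front_sd \<alpha> \<gamma> T"
  proof -
    have "1 / 16 \<le> real n * (1 / (4 * real T))" using nT T by (simp add: field_simps)
    also have "\<dots> = (\<Sum>s=1..n. 1 / (4 * real T))" by simp
    also have "\<dots> \<le> (\<Sum>s=1..n. (path_weight \<alpha> T s)\<^sup>2)"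
    proof (intro sum_mono lower)
      fix s assume s: "s \<in> {1..n}"
      have "real k \<le> real (Suc T - s)" using s n kT by (intro of_nat_mono) auto
      then show "A \<le> real (Suc T - s)" using AP k P by simp
    qed (use n1 in auto)
    finally have "sqrt (1 / 16) \<le> front_sd \<alpha> \<gamma> T" unfolding front_sd_def n_def by (rule real_sqrt_le_mono)
    moreover have "sqrt (1 / 16) = (1 / 4 :: real)" by (simp add: real_sqrt_divide)
    ultimately show ?thesis by simp
  qed
  show "(front_sd \<alpha> \<gamma> T)\<^sup>2 \<le> 1 + 2 / (1 - \<alpha>)\<^sup>2 * real T powr (\<alpha> - 1)"
    using sum_weight_sq_le[OF \<alpha>, of n T] n1 T
    by (simp add: front_sd_def n_def path_weight_def sum_nonneg)
  have PTg: "P / real T = (real T powr (- \<gamma>))\<^sup>2"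
    using T by (simp add: P_def powr_diff powr_minus_divide power2_eq_square powr_add[symmetric] power_divide)
  show "real T powr (- \<gamma>) / 3 \<le> tail_sd \<alpha> \<gamma> T"
  proof -
    define j where "j = nat \<lceil>A\<rceil>"
    have j: "A \<le> real j" "real j \<le> A + 1" using P by (auto simp: j_def)
    have jk: "j \<le> k" using j k AP P4 by linarith
    have "(real T powr (- \<gamma>) / 3)\<^sup>2 = P / (9 * real T)" using PTg by (simp add: power_divide)
    also have "\<dots> \<le> (P / 2) * (1 / (4 * real T))" using T P by (simp add: field_simps)
    also have "\<dots> \<le> real (k - j) * (1 / (4 * real T))"
      using jk k j AP P4 T by (intro mult_right_mono) (auto simp: of_nat_diff)
    also have "\<dots> = (\<Sum>s\<in>{n<..T - j}. 1 / (4 * real T))" using n kT jk by simp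
    also have "\<dots> \<le> (\<Sum>s\<in>{n<..T - j}. (path_weight \<alpha> T s)\<^sup>2)"
    proof (intro sum_mono lower)
      fix s assume s: "s \<in> {n<..T - j}"
      have "real j \<le> real (Suc T - s)" using s jk kT by (intro of_nat_mono) auto
      then show "A \<le> real (Suc T - s)" using j by simp
    qed auto
    also have "\<dots> \<le> (\<Sum>s\<in>{n<..T}. (path_weight \<alpha> T s)\<^sup>2)" by (intro sum_mono2) auto
    finally show ?thesis unfolding tail_sd_def n_def by (rule real_le_rsqrt)
  qed
  show "tail_sd \<alpha> \<gamma> T \<le> 2 / (1 - \<alpha>) * real T powr (- \<gamma>)"
  proof -
    have up: "(path_weight \<alpha> T s)\<^sup>2 \<le> 1 / ((1 - \<alpha>)\<^sup>2 * real T)" if s: "s \<in> {n<..T}" for s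
    proof -
      have s1: "1 \<le> s" "s \<le> T" using s by auto
      have "real s powr (\<alpha> - 1) \<le> 1" using powr_mono[of "\<alpha> - 1" 0 "real s"] s1 \<alpha> by simp
      then have "\<alpha> * real s powr (\<alpha> - 1) \<le> \<alpha>" using \<alpha> by (simp add: mult_le_cancel_left2)
      then have "1 / (1 - \<alpha> * real s powr (\<alpha> - 1)) \<le> 1 / (1 - \<alpha>)" using \<alpha> by (intro frac_le) auto
      with weight_le[OF \<alpha> s1] have w: "weight \<alpha> T s \<le> 1 / (1 - \<alpha>)" by simp
      have "(weight \<alpha> T s)\<^sup>2 \<le> (1 / (1 - \<alpha>))\<^sup>2"
        using w weight_nonneg[OF \<alpha>(1) s1(1)] by (intro power_mono) auto
      then have "(weight \<alpha> T s)\<^sup>2 / real T \<le> (1 / (1 - \<alpha>))\<^sup>2 / real T" using T by (intro divide_right_mono) auto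
      then show ?thesis unfolding sq by (simp add: power_divide)
    qed
    have "(\<Sum>s\<in>{n<..T}. (path_weight \<alpha> T s)\<^sup>2) \<le> (\<Sum>s\<in>{n<..T}. 1 / ((1 - \<alpha>)\<^sup>2 * real T))"
      by (intro sum_mono up)
    also have "\<dots> = real k * (1 / ((1 - \<alpha>)\<^sup>2 * real T))" using n kT by simp
    also have "\<dots> \<le> (4 * P) * (1 / ((1 - \<alpha>)\<^sup>2 * real T))" using k P4 T by (intro mult_right_mono) auto
    also have "\<dots> = 4 / (1 - \<alpha>)\<^sup>2 * (P / real T)" by simp
    also have "\<dots> = (2 / (1 - \<alpha>) * real T powr (- \<gamma>))\<^sup>2"
      unfolding PTg by (simp add: power_mult_distrib power_divide)
    finally show ?thesis unfolding tail_sd_def n_def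
      using \<alpha> by (intro real_le_lsqrt) (auto simp: sum_nonneg)
  qed
  show "path_weight \<alpha> T s \<noteq> 0" if "s \<in> {1..T}" for s
    using weight_pos[OF \<alpha>(1), of s T] that T by (simp add: path_weight_def)
qed

text \<open>
  The threshold of the switch is the standard deviation of the noise that the switch would suppress.
\<close>

definition worst_oracle :: "real \<Rightarrow> real \<Rightarrow> real \<Rightarrow> nat \<Rightarrow> (nat \<Rightarrow> real) sa_oracle" where
  "worst_oracle \<eta> \<alpha> \<gamma> T = freezing_oracle \<eta> (freeze_start \<gamma> T) T (path_weight \<alpha> T) (tail_sd \<alpha> \<gamma> T)"

lemma prob_near_zero_le:
  assumes "1 \<le> n" "c 1 \<noteq> 0" "0 \<le> \<epsilon>"
  shows "gauss_seq.prob (near_zero n c \<epsilon>) \<le> \<epsilon> / sqrt (\<Sum>s=1..n. (c s)\<^sup>2)"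
proof -
  define \<sigma> where "\<sigma> = sqrt (\<Sum>s=1..n. (c s)\<^sup>2)"
  have \<sigma>: "0 < \<sigma>" unfolding \<sigma>_def using assms by (auto intro!: sum_pos2[of _ 1])
  have d: "distributed gauss_seq lborel (\<lambda>\<omega>. \<Sum>s=1..n. c s * \<omega> s) (normal_density 0 \<sigma>)"
    unfolding \<sigma>_def using assms by (intro distributed_lincomb[where i = 1]) auto
  have "near_zero n c \<epsilon> = (\<lambda>\<omega>. \<Sum>s=1..n. c s * \<omega> s) -` {-\<epsilon><..<\<epsilon>} \<inter> space gauss_seq"
    by (auto simp: near_zero_def)
  then have "gauss_seq.prob (near_zero n c \<epsilon>) \<le> (\<epsilon> - - \<epsilon>) / (\<sigma> * sqrt (2 * pi))"
    using assms by (simp only:) (intro gauss_seq.normal_prob_le[OF d \<sigma>], auto)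
  also have "\<dots> = \<epsilon> / \<sigma> * (2 / sqrt (2 * pi))" by simp
  also have "\<dots> \<le> \<epsilon> / \<sigma> * 1"
  proof (rule mult_left_mono)
    have "2 \<le> sqrt (2 * pi)" using pi_ge_two by (intro real_le_rsqrt) (simp add: power2_eq_square)
    then show "2 / sqrt (2 * pi) \<le> 1" by simp
  qed (use \<sigma> assms in auto)
  finally show ?thesis by (simp add: \<sigma>_def)
qed

text \<open>
  The bound of \<open>cond_A4_freezing\<close> is of order \<open>T powr (- \<gamma>) * T powr (1 - 2 \<gamma>) / m\<close>. It is needed for \<open>m > n\<close>
  only, where \<open>T < 2 m\<close>; as \<open>1 - 3 \<gamma> > 0\<close>, this lets \<open>m\<close> replace \<open>T\<close>.
\<close>

lemma cond_A4_worst_oracle: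
  fixes \<alpha> \<gamma> :: real and T :: nat
  assumes \<alpha>: "0 < \<alpha>" "\<alpha> < 1" and \<gamma>: "0 < \<gamma>" "\<gamma> < 1 / 3" and "4 \<le> T"
    and d: "real T powr (\<alpha> - (1 - 2 * \<gamma>)) \<le> 1 / 4"
     "real T powr (- (1 - 2 * \<gamma>)) \<le> 1 / 4" "real T powr (- (2 * \<gamma>)) \<le> 1 / 4"
  shows "cond_A4 (worst_oracle \<eta> \<alpha> \<gamma> T) 1 (32 / (1 - \<alpha>)) \<gamma>"
  unfolding worst_oracle_def
proof (rule cond_A4_freezing)
  define n where "n = freeze_start \<gamma> T"
  have "\<gamma> < 1 / 2" using \<gamma> by simp
  note b = sd_bounds[OF \<alpha> \<gamma>(1) this \<open>4 \<le> T\<close> d, folded n_def]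
  have T: "real T > 0" using \<open>4 \<le> T\<close> by simp
  show "freeze_start \<gamma> T \<le> T" using b by (simp add: n_def)
  show "0 \<le> 32 / (1 - \<alpha>)" using \<alpha> by simp
  fix m :: nat assume m: "2 \<le> m" "freeze_start \<gamma> T < m"
  have "gauss_seq.prob (near_zero n (path_weight \<alpha> T) (tail_sd \<alpha> \<gamma> T)) \<le> tail_sd \<alpha> \<gamma> T / front_sd \<alpha> \<gamma> T"
    unfolding front_sd_def n_def[symmetric] using b
    by (intro prob_near_zero_le) (auto simp: tail_sd_def sum_nonneg)
  also have "\<dots> \<le> (2 / (1 - \<alpha>) * real T powr (- \<gamma>)) / (1 / 4)"
    using b(5,8) \<alpha> by (intro frac_le) auto
  finally have p: "gauss_seq.prob (near_zero n (path_weight \<alpha> T) (tail_sd \<alpha> \<gamma> T)) \<le> 8 / (1 - \<alpha>) * real T powr (- \<gamma>)"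
    by simp
  have "gauss_seq.prob (near_zero n (path_weight \<alpha> T) (tail_sd \<alpha> \<gamma> T)) * (real (T - n) / real m)
      \<le> (8 / (1 - \<alpha>) * real T powr (- \<gamma>)) * (2 * real T powr (1 - 2 * \<gamma>) / real m)"
    using p b(4) \<alpha> by (intro mult_mono divide_right_mono) auto
  also have "\<dots> = 16 / (1 - \<alpha>) * (real T powr (1 - 3 * \<gamma>) / real m)"
    by (simp add: powr_add[symmetric])
  also have "\<dots> \<le> 16 / (1 - \<alpha>) * (2 * real m powr (- 3 * \<gamma>))"
  proof (rule mult_left_mono)
    have "real T powr (1 - 3 * \<gamma>) \<le> 2 * real m powr (1 - 3 * \<gamma>)"
    proof (cases "m \<le> T")
      case True
      have "real T powr (1 - 3 * \<gamma>) \<le> (2 * real m) powr (1 - 3 * \<gamma>)"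
        using b(3) m \<gamma> by (intro powr_mono2) (auto simp: n_def)
      also have "\<dots> = 2 powr (1 - 3 * \<gamma>) * real m powr (1 - 3 * \<gamma>)" by (simp add: powr_mult)
      also have "\<dots> \<le> 2 powr 1 * real m powr (1 - 3 * \<gamma>)"
        using \<gamma> by (intro mult_right_mono powr_mono) auto
      finally show ?thesis by simp
    next
      case False
      then have "real T powr (1 - 3 * \<gamma>) \<le> real m powr (1 - 3 * \<gamma>)"
        using \<gamma> by (intro powr_mono2) auto
      then show ?thesis using powr_ge_zero[of "real m" "1 - 3 * \<gamma>"] by linarith
    qed
    moreover have "real m powr (1 - 3 * \<gamma>) = real m * real m powr (- 3 * \<gamma>)"
      using m by (simp add: powr_diff powr_minus_divide)
    ultimately show "real T powr (1 - 3 * \<gamma>) / real m \<le> 2 * real m powr (- 3 * \<gamma>)"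
      using m by (simp add: field_simps)
  qed (use \<alpha> in simp)
  finally show "gauss_seq.prob (near_zero (freeze_start \<gamma> T) (path_weight \<alpha> T) (tail_sd \<alpha> \<gamma> T)) *
      (real (T - freeze_start \<gamma> T) / real m) \<le> 32 / (1 - \<alpha>) * real m powr (- 3 * \<gamma>)"
    by (simp add: n_def)
qed

section \<open>The lower bound\<close>

text \<open>
  An admissible \<open>\<delta>\<close> satisfies \<open>\<epsilon> (2 + r / 2) / \<surd>(2 \<pi>) \<le> 2 (\<epsilon> + \<delta> / \<eta>) / \<surd>(2 \<pi>) + \<delta>\<close>, where
  \<open>r = exp (- 2) / \<surd>(2 \<pi>)\<close>. The terms \<open>2 \<epsilon> / \<surd>(2 \<pi>)\<close> cancel, and half of the gain \<open>r\<close> is left to bound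
  \<open>\<delta>\<close> from below.
\<close>

lemma prokhorov_dist_worst_oracle_ge:
  fixes \<eta> \<alpha> \<gamma> :: real and T :: nat
  assumes "\<eta> > 0" "1 \<le> freeze_start \<gamma> T" "freeze_start \<gamma> T < T"
    and nz: "\<And>s. s \<in> {1..T} \<Longrightarrow> path_weight \<alpha> T s \<noteq> 0"
    and BM: "standard_brownian_motion N W"
    and gain: "2 + exp (- 2) / sqrt (2 * pi) / 2 \<le> exp (- 2 * (tail_sd \<alpha> \<gamma> T)\<^sup>2 / (front_sd \<alpha> \<gamma> T)\<^sup>2)
       / front_sd \<alpha> \<gamma> T * (2 + exp (- 2) / sqrt (2 * pi))"
  shows "ereal (tail_sd \<alpha> \<gamma> T * (exp (- 2) / (4 * pi) / (1 + 2 / (\<eta> * sqrt (2 * pi)))))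
    \<le> prokhorov_dist (distr (law (worst_oracle \<eta> \<alpha> \<gamma> T)) skorokhod_borel
          (sa_path (step_size \<eta> \<alpha>) T (worst_oracle \<eta> \<alpha> \<gamma> T)))
        (distr N skorokhod_borel (target_path W (1 / \<eta>) 1))"
  unfolding prokhorov_dist_def
proof (rule INF_greatest)
  define \<epsilon> where "\<epsilon> = tail_sd \<alpha> \<gamma> T"
  define \<sigma> where "\<sigma> = front_sd \<alpha> \<gamma> T"
  define n where "n = freeze_start \<gamma> T"
  define R where "R = sqrt (2 * pi)"
  define r where "r = exp (- 2) / R"
  let ?M = "worst_oracle \<eta> \<alpha> \<gamma> T"
  let ?\<Gamma> = "{f \<in> cadlag_space. \<bar>f 1\<bar> < \<eta> * \<epsilon>}"
  have R: "0 < R" "R * R = 2 * pi" by (auto simp: R_def)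
  have "0 < (\<Sum>s\<in>{n<..T}. (path_weight \<alpha> T s)\<^sup>2)"
    using assms nz[of T] by (intro sum_pos2[of _ T]) (auto simp: n_def)
  then have \<epsilon>: "0 < \<epsilon>" by (simp add: \<epsilon>_def tail_sd_def n_def)
  fix \<delta> assume "\<delta> \<in> {\<delta>. 0 < \<delta> \<and> (\<forall>\<Gamma>\<in>sets skorokhod_borel.
      measure (distr (law ?M) skorokhod_borel (sa_path (step_size \<eta> \<alpha>) T ?M)) \<Gamma>
        \<le> measure (distr N skorokhod_borel (target_path W (1 / \<eta>) 1)) (skorokhod_nbhd \<Gamma> \<delta>) + \<delta> \<and>
      measure (distr N skorokhod_borel (target_path W (1 / \<eta>) 1)) \<Gamma>
        \<le> measure (distr (law ?M) skorokhod_borel (sa_path (step_size \<eta> \<alpha>) T ?M)) (skorokhod_nbhd \<Gamma> \<delta>) + \<delta>)}"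
  then have \<delta>: "0 < \<delta>" and valid: "measure (distr (law ?M) skorokhod_borel (sa_path (step_size \<eta> \<alpha>) T ?M)) ?\<Gamma>
      \<le> measure (distr N skorokhod_borel (target_path W (1 / \<eta>) 1)) (skorokhod_nbhd ?\<Gamma> \<delta>) + \<delta>"
    using endpoint_ball_in_borel[of "\<eta> * \<epsilon>"] by auto
  have "\<epsilon> / R * (2 + r / 2) \<le> \<epsilon> / R * (exp (- 2 * \<epsilon>\<^sup>2 / \<sigma>\<^sup>2) / \<sigma> * (2 + r))"
    using gain \<epsilon> R by (intro mult_left_mono) (auto simp: \<epsilon>_def \<sigma>_def R_def r_def)
  also have "\<dots> = \<epsilon> / (\<sigma> * R) * exp (- 2 * \<epsilon>\<^sup>2 / \<sigma>\<^sup>2) * (2 + r)" by (simp add: mult_ac)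
  also have "\<dots> \<le> gauss_seq.prob {\<omega>. \<bar>final_value n T (path_weight \<alpha> T) \<epsilon> \<omega>\<bar> < \<epsilon>}"
    using prob_final_value_near_zero_ge[of n T "path_weight \<alpha> T"] assms nz
    by (simp add: n_def \<epsilon>_def \<sigma>_def front_sd_def tail_sd_def r_def R_def)
  also have "\<dots> = measure (distr (law ?M) skorokhod_borel (sa_path (step_size \<eta> \<alpha>) T ?M)) ?\<Gamma>"
    using prob_path_endpoint[of \<eta> T \<alpha> n \<epsilon>] assms
    by (simp add: worst_oracle_def n_def \<epsilon>_def path_weight_def[abs_def])
  also have "\<dots> \<le> 2 * (\<epsilon> + \<delta> / \<eta>) / R + \<delta>"
    using valid target_endpoint_le[OF BM \<open>\<eta> > 0\<close> \<epsilon> \<delta>] by (simp add: R_def)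
  also have "\<dots> = \<epsilon> / R * 2 + \<delta> * (1 + 2 / (\<eta> * R))"
    by (simp add: add_divide_distrib distrib_left mult.commute[of _ 2])
  finally have "\<epsilon> / R * (r / 2) \<le> \<delta> * (1 + 2 / (\<eta> * R))"
    unfolding distrib_left[of "\<epsilon> / R"] by linarith
  moreover have "\<epsilon> / R * (r / 2) = \<epsilon> * (exp (- 2) / (4 * pi))"
  proof -
    have "\<epsilon> / R * (r / 2) = \<epsilon> * exp (- 2) / (2 * (R * R))" by (simp add: r_def)
    then show ?thesis unfolding R(2) by simp
  qed
  moreover have "0 < 1 + 2 / (\<eta> * R)" using assms R by (intro add_pos_pos) auto
  ultimately have "\<epsilon> * (exp (- 2) / (4 * pi)) / (1 + 2 / (\<eta> * R)) \<le> \<delta>"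
    by (simp only: pos_divide_le_eq)
  then show "ereal (tail_sd \<alpha> \<gamma> T * (exp (- 2) / (4 * pi) / (1 + 2 / (\<eta> * sqrt (2 * pi))))) \<le> ereal \<delta>"
    by (simp add: \<epsilon>_def R_def)
qed

text \<open>
  The value of the density of \<open>Y\<close> near 0 may fall short of the standard normal one by a factor tending to 1.
  The choice of \<open>\<kappa>\<close> makes \<open>(1 - 2 \<kappa>) (2 + r) = 2 + r / 2\<close>, so that this loss costs at most half of the
  gain \<open>r\<close>.
\<close>

lemma density_gain:
  fixes \<sigma> \<epsilon> r \<kappa> :: real
  assumes "1 / 4 \<le> \<sigma>" "\<sigma>\<^sup>2 \<le> 1 + \<kappa>" "32 * \<epsilon>\<^sup>2 \<le> \<kappa>" "0 < r" "\<kappa> = r / (4 * (2 + r))"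
  shows "2 + r / 2 \<le> exp (- 2 * \<epsilon>\<^sup>2 / \<sigma>\<^sup>2) / \<sigma> * (2 + r)"
proof -
  have \<kappa>: "0 < \<kappa>" "\<kappa> \<le> 1" "\<kappa> * (2 + r) = r / 4"
    unfolding assms(5) using \<open>0 < r\<close> by (auto simp: divide_simps)
  have s: "1 / 16 \<le> \<sigma>\<^sup>2"
    using power_mono[of "1/4" \<sigma> 2] assms by (simp add: power2_eq_square)
  have "\<epsilon>\<^sup>2 / \<sigma>\<^sup>2 \<le> \<epsilon>\<^sup>2 / (1 / 16)" using s by (intro divide_left_mono) auto
  then have "1 - \<kappa> \<le> 1 + (- 2 * \<epsilon>\<^sup>2 / \<sigma>\<^sup>2)" using assms by simp
  also have "\<dots> \<le> exp (- 2 * \<epsilon>\<^sup>2 / \<sigma>\<^sup>2)" by (rule exp_ge_add_one_self)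
  finally have e: "1 - \<kappa> \<le> exp (- 2 * \<epsilon>\<^sup>2 / \<sigma>\<^sup>2)" .
  have "\<sigma> \<le> 1 + \<kappa>"
  proof (cases "\<sigma> \<le> 1")
    case False
    then have "\<sigma> * 1 \<le> \<sigma> * \<sigma>" by (intro mult_left_mono) auto
    then show ?thesis using assms(2) unfolding power2_eq_square by linarith
  qed (use \<kappa> in simp)
  then have "(1 - \<kappa>) * \<sigma> \<le> (1 - \<kappa>) * (1 + \<kappa>)" using \<kappa> by (intro mult_left_mono) auto
  also have "\<dots> \<le> 1" by (simp add: algebra_simps)
  finally have i: "1 - \<kappa> \<le> 1 / \<sigma>" using assms(1) by (simp add: pos_le_divide_eq)
  have "2 + r / 2 = (1 - 2 * \<kappa>) * (2 + r)" using \<kappa>(3) by (simp add: algebra_simps)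
  also have "\<dots> \<le> ((1 - \<kappa>) * (1 - \<kappa>)) * (2 + r)"
    using assms by (intro mult_right_mono) (auto simp: algebra_simps)
  also have "\<dots> \<le> (exp (- 2 * \<epsilon>\<^sup>2 / \<sigma>\<^sup>2) * (1 / \<sigma>)) * (2 + r)"
    using \<kappa> e i assms by (intro mult_right_mono mult_mono) auto
  finally show ?thesis by simp
qed

theorem theorem3p3:
  fixes \<eta> \<alpha> p q \<gamma> :: real
  assumes "\<eta> > 0" and "1 / 2 < \<alpha>" and "\<alpha> < 1"
    and "p > 2" and "1 \<le> q" and "q \<le> p / 2"
    and "\<gamma> > 0" and "\<gamma> < min ((p - 2) / (2 * (p + 1))) ((1 - \<alpha>) / 2)"
  shows "\<exists>(\<CC> :: (nat \<Rightarrow> real) sa_oracle set) G S.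
           uniform_class \<CC> G S (step_size \<eta> \<alpha>) p q \<gamma> \<and> (\<forall>M\<in>\<CC>. S M = 1) \<and>
           (\<exists>c>0. \<exists>T0::nat. \<forall>T\<ge>T0. \<forall>(N :: 'v measure) W. standard_brownian_motion N W \<longrightarrow>
              worst_case_error N W (step_size \<eta> \<alpha>) T \<CC> G S \<ge> ereal (c * real T powr (- \<gamma>)))"
proof -
  have \<alpha>: "0 < \<alpha>" "\<alpha> < 1" using assms by auto
  have \<gamma>: "0 < \<gamma>" "\<gamma> < 1 / 3" "\<gamma> < 1 / 2" "2 * \<gamma> < 1 - \<alpha>" using assms by auto
  define r where "r = exp (- 2) / sqrt (2 * pi)"
  have r: "0 < r" by (simp add: r_def)
  define \<kappa> where "\<kappa> = r / (4 * (2 + r))"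
  have \<kappa>: "0 < \<kappa>" using r by (simp add: \<kappa>_def)
  define C where "C = 128 / (1 - \<alpha>)\<^sup>2"
  have C: "0 < C" using \<alpha> by (simp add: C_def)
  define D where "D = 2 / (1 - \<alpha>)\<^sup>2"
  have D: "0 < D" using \<alpha> by (simp add: D_def)
  have "\<forall>\<^sub>F T in sequentially. 4 \<le> T \<and> real T powr (- (1 - 2 * \<gamma> - \<alpha>)) \<le> 1 / 4
      \<and> real T powr (- (1 - 2 * \<gamma>)) \<le> 1 / 4 \<and> real T powr (- (2 * \<gamma>)) \<le> 1 / 4
      \<and> real T powr (- (1 - \<alpha>)) \<le> \<kappa> / D \<and> real T powr (- (2 * \<gamma>)) \<le> \<kappa> / C"
    using \<gamma> \<alpha> \<kappa> C D
    by (intro eventually_conj eventually_powr_neg_le eventually_ge_at_top) (auto simp: field_simps)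
  \<comment> \<open>The first four conditions are those of \<open>sd_bounds\<close>; the last two bring the variance of the part before
    the window and the width of the interval into the range of \<open>density_gain\<close>.\<close>
  then obtain T0 where T0: "\<And>T. T \<ge> T0 \<Longrightarrow> 4 \<le> T \<and> real T powr (- (1 - 2 * \<gamma> - \<alpha>)) \<le> 1 / 4
      \<and> real T powr (- (1 - 2 * \<gamma>)) \<le> 1 / 4 \<and> real T powr (- (2 * \<gamma>)) \<le> 1 / 4
      \<and> real T powr (- (1 - \<alpha>)) \<le> \<kappa> / D \<and> real T powr (- (2 * \<gamma>)) \<le> \<kappa> / C"
    unfolding eventually_sequentially by auto
  define \<CC> where "\<CC> = worst_oracle \<eta> \<alpha> \<gamma> ` {T0..}"
  define K where "K = exp (- 2) / (4 * pi) / (1 + 2 / (\<eta> * sqrt (2 * pi)))"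
  have K: "0 < K" unfolding K_def using assms by (intro divide_pos_pos add_pos_pos) auto
  have T0': "4 \<le> T" "real T powr (\<alpha> - (1 - 2 * \<gamma>)) \<le> 1 / 4"
      "real T powr (- (1 - 2 * \<gamma>)) \<le> 1 / 4" "real T powr (- (2 * \<gamma>)) \<le> 1 / 4" if "T \<ge> T0" for T
    using T0[OF that] by (auto simp: algebra_simps)
  show ?thesis
  proof (intro exI conjI)
    show "uniform_class \<CC> (\<lambda>_. 1 / \<eta>) (\<lambda>_. 1) (step_size \<eta> \<alpha>) p q \<gamma>"
      unfolding uniform_class_def
    proof (intro exI ballI)
      fix M assume "M \<in> \<CC>"
      then obtain T where T: "T \<ge> T0" "M = worst_oracle \<eta> \<alpha> \<gamma> T" by (auto simp: \<CC>_def)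
      show "stochastic_oracle M \<and> cond_A1 (mean_field M) (1 / \<eta>) 1 0 0 \<and> cond_A3 M p (abs_moment p) \<and>
          cond_A4 M 1 (32 / (1 - \<alpha>)) \<gamma> \<and>
          cond_A5 M (step_size \<eta> \<alpha>) q (2 * \<eta> powr q * abs_moment (2 * q) / (1 - \<alpha>) powr q)"
      proof (intro conjI)
        show "cond_A4 M 1 (32 / (1 - \<alpha>)) \<gamma>"
          unfolding T(2) using T0'[OF T(1)] \<alpha> \<gamma> by (intro cond_A4_worst_oracle)
        show "stochastic_oracle M" "cond_A1 (mean_field M) (1 / \<eta>) 1 0 0" "cond_A3 M p (abs_moment p)"
          "cond_A5 M (step_size \<eta> \<alpha>) q (2 * \<eta> powr q * abs_moment (2 * q) / (1 - \<alpha>) powr q)"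
          unfolding T(2) worst_oracle_def using assms \<alpha>
          by (auto intro!: stochastic_oracle_freezing cond_A1_linear cond_A3_freezing cond_A5_freezing)
      qed
    qed
    show "\<forall>M\<in>\<CC>. (1 :: real) = 1" by simp
    show "K / 3 > 0" using K by simp
    show "\<forall>T\<ge>T0. \<forall>(N :: 'v measure) W. standard_brownian_motion N W \<longrightarrow>
        ereal (K / 3 * real T powr (- \<gamma>)) \<le> worst_case_error N W (step_size \<eta> \<alpha>) T \<CC> (\<lambda>_. 1 / \<eta>) (\<lambda>_. 1)"
    proof (intro allI impI)
      fix T :: nat and N :: "'v measure" and W
      assume T: "T \<ge> T0" and BM: "standard_brownian_motion N W"
      note b = sd_bounds[OF \<alpha> \<gamma>(1,3) T0'[OF T]]
      define \<epsilon> where "\<epsilon> = tail_sd \<alpha> \<gamma> T"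
      have "(front_sd \<alpha> \<gamma> T)\<^sup>2 \<le> 1 + \<kappa>"
      proof -
        have "D * real T powr (\<alpha> - 1) \<le> \<kappa>"
          using T0[OF T] D by (simp add: pos_le_divide_eq mult.commute)
        then show ?thesis using b(6) by (simp add: D_def)
      qed
      moreover have "32 * \<epsilon>\<^sup>2 \<le> \<kappa>"
      proof -
        have "0 \<le> \<epsilon>" by (simp add: \<epsilon>_def tail_sd_def sum_nonneg)
        then have "\<epsilon>\<^sup>2 \<le> (2 / (1 - \<alpha>) * real T powr (- \<gamma>))\<^sup>2" using b(8) by (intro power_mono) (auto simp: \<epsilon>_def)
        also have "\<dots> = 4 / (1 - \<alpha>)\<^sup>2 * real T powr (- (2 * \<gamma>))"
          by (simp add: power_mult_distrib power_divide power2_eq_square powr_add[symmetric])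
        finally have "32 * \<epsilon>\<^sup>2 \<le> C * real T powr (- (2 * \<gamma>))" by (simp add: C_def)
        also have "\<dots> \<le> \<kappa>" using T0[OF T] C by (simp add: pos_le_divide_eq mult.commute)
        finally show ?thesis .
      qed
      ultimately have gain: "2 + r / 2 \<le> exp (- 2 * \<epsilon>\<^sup>2 / (front_sd \<alpha> \<gamma> T)\<^sup>2) / front_sd \<alpha> \<gamma> T * (2 + r)"
        using b(5) r by (intro density_gain) (auto simp: \<kappa>_def)
      have "ereal (K / 3 * real T powr (- \<gamma>)) \<le> ereal (\<epsilon> * K)"
        using mult_right_mono[OF b(7), of K] K by (simp add: \<epsilon>_def mult.commute)
      also have "\<dots> \<le> prokhorov_dist
          (distr (law (worst_oracle \<eta> \<alpha> \<gamma> T)) skorokhod_borel (sa_path (step_size \<eta> \<alpha>) T (worst_oracle \<eta> \<alpha> \<gamma> T)))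
          (distr N skorokhod_borel (target_path W (1 / \<eta>) 1))"
        unfolding K_def \<epsilon>_def
        using gain b(9) by (intro prokhorov_dist_worst_oracle_ge assms(1) b(1) b(2) BM) (auto simp: \<epsilon>_def r_def)
      also have "\<dots> \<le> worst_case_error N W (step_size \<eta> \<alpha>) T \<CC> (\<lambda>_. 1 / \<eta>) (\<lambda>_. 1)"
        unfolding worst_case_error_def by (rule SUP_upper) (use T in \<open>simp add: \<CC>_def\<close>)
      finally show "ereal (K / 3 * real T powr (- \<gamma>)) \<le> worst_case_error N W (step_size \<eta> \<alpha>) T \<CC> (\<lambda>_. 1 / \<eta>) (\<lambda>_. 1)" .
    qed
  qed
qed

end
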